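(* Let $E$ be a complex Banach lattice, let $A$ be a closed, densely defined and real operator on $E$, and suppose that $\lambda_0\in\mathbb{R}$ is an eigenvalue of $A$ and a pole of $R(\cdot,A)$, with associated spectral projection $P$. Let $0 \le u \in E$ and assume that $D(A) \subseteq E_u$. Then $u$ is a quasi-interior point of $E_+$ and the following assertions are equivalent: (i) $P \gg_u 0$. (ii) The resolvent $R(\cdot,A)$ is individually eventually strongly positive with respect to $u$ at $\lambda_0$. (iii) The resolvent $R(\cdot,A)$ is individually eventually strongly negative with respect to $u$ at $\lambda_0$. If moreover $\lambda_0 = s(A)$, then (i)--(iii) are also equivalent to: (iv) There exists $\lambda > s(A)$ such that the operator $R(\lambda,A)$ is individually eventually strongly positive with respect to $u$. (v) For every $\lambda > s(A)$ the operator $R(\lambda,A)$ is individually eventually strongly positive with respect to $u$.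
   Context: $E$ is the complexification of a real Banach lattice $E_\mathbb{R}$; $E_+$ is the positive cone, $f>0$ means $f\in E_+\setminus\{0\}$. For $u\in E_+$, $E_u=\{f: |f|\le cu \text{ for some } c\ge0\}$; $u$ is quasi-interior if $E_u$ is dense. For quasi-interior $u$, $f\gg_u 0$ means $f\ge cu$ for some $c>0$, $f \ll_u 0$ means $-f\gg_u 0$, and $T\gg_u 0$ means $Tf\gg_u0$ for all $f>0$. $A$ is real if $D(A)=(D(A)\cap E_\mathbb{R})+i(D(A)\cap E_\mathbb{R})$ and $A(D(A)\cap E_\mathbb{R})\subseteq E_\mathbb{R}$. $s(A)=\sup\{\operatorname{Re}\lambda:\lambda\in\sigma(A)\}$ is the spectral bound; $P$ is the residue of $R(\cdot,A)$ at $\lambda_0$. Definitions (for a closed real operator $A$, a quasi-interior point $u$ and a real spectral value $\lambda_0$): $R(\cdot,A)$ is individually eventually strongly positive with respect to $u$ at $\lambda_0$ if there is $\lambda_2>\lambda_0$ with $(\lambda_0,\lambda_2]\subseteq\rho(A)$ such that for each $f>0$ there is $\lambda_1\in(\lambda_0,\lambda_2]$ with $R(\lambda,A)f\gg_u 0$ for all $\lambda\in(\lambda_0,\lambda_1]$. $R(\cdot,A)$ is individually eventually strongly negative with respect to $u$ at $\lambda_0$ if there is $\lambda_2<\lambda_0$ with $[\lambda_2,\lambda_0)\subseteq\rho(A)$ such that for each $f>0$ there is $\lambda_1\in[\lambda_2,\lambda_0)$ with $R(\lambda,A)f\ll_u0$ for all $\lambda\in[\lambda_1,\lambda_0)$.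 A bounded operator $T$ on $E$ is individually eventually strongly positive with respect to $u$ if for every $f>0$ there is $n_0\in\mathbb{N}$ with $T^nf\gg_u 0$ for all $n\ge n_0$. *)

theory Defs
  imports "HOL-Analysis.Analysis"
begin

class real_banach_lattice = banach + lattice + ordered_ab_group_add +
  assumes scaleR_nonneg_nonneg_bl: "0 \<le> a \<Longrightarrow> 0 \<le> x \<Longrightarrow> 0 \<le> a *\<^sub>R x"
  assumes norm_lattice_bl: "sup x (- x) \<le> sup y (- y) \<Longrightarrow> norm x \<le> norm y"

definition labs :: "'r::real_banach_lattice \<Rightarrow> 'r" where
  "labs x = sup x (- x)"

section \<open>Complexification E = E_R + i E_R, represented by pairs (x, y) = x + i y\<close>

definition cscale :: "complex \<Rightarrow> 'r::real_banach_lattice \<times> 'r \<Rightarrow> 'r \<times> 'r" where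
  "cscale c f = (Re c *\<^sub>R fst f - Im c *\<^sub>R snd f, Im c *\<^sub>R fst f + Re c *\<^sub>R snd f)"

definition ERe :: "('r::real_banach_lattice \<times> 'r) set" where
  "ERe = {f. snd f = 0}"

definition cpos :: "'r::real_banach_lattice \<times> 'r \<Rightarrow> bool" where
  "cpos f \<longleftrightarrow> snd f = 0 \<and> 0 \<le> fst f"

definition cstrictpos :: "'r::real_banach_lattice \<times> 'r \<Rightarrow> bool" where
  "cstrictpos f \<longleftrightarrow> cpos f \<and> f \<noteq> 0"

text \<open>Principal ideal E_u = {f. |f| \<le> c u for some c \<ge> 0}, where the modulus of
  x + i y is |x + i y| = sup_\<theta> |cos \<theta> x + sin \<theta> y|; so |f| \<le> c u unfolds to
  |cos \<theta> x + sin \<theta> y| \<le> c u for all \<theta>.\<close>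
definition principal_ideal :: "'r::real_banach_lattice \<times> 'r \<Rightarrow> ('r \<times> 'r) set" where
  "principal_ideal u = {f. \<exists>c\<ge>0. \<forall>\<theta>::real.
      labs (cos \<theta> *\<^sub>R fst f + sin \<theta> *\<^sub>R snd f) \<le> c *\<^sub>R fst u}"

definition quasi_interior :: "'r::real_banach_lattice \<times> 'r \<Rightarrow> bool" where
  "quasi_interior u \<longleftrightarrow> cpos u \<and> closure (principal_ideal u) = UNIV"

definition strongly_pos :: "'r::real_banach_lattice \<times> 'r \<Rightarrow> 'r \<times> 'r \<Rightarrow> bool" where
  "strongly_pos u f \<longleftrightarrow> (\<exists>c>0. cpos (f - c *\<^sub>R u))"

definition strongly_neg :: "'r::real_banach_lattice \<times> 'r \<Rightarrow> 'r \<times> 'r \<Rightarrow> bool" where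
  "strongly_neg u f \<longleftrightarrow> strongly_pos u (- f)"

definition op_strongly_pos :: "'r::real_banach_lattice \<times> 'r \<Rightarrow> ('r \<times> 'r \<Rightarrow> 'r \<times> 'r) \<Rightarrow> bool" where
  "op_strongly_pos u T \<longleftrightarrow> (\<forall>f. cstrictpos f \<longrightarrow> strongly_pos u (T f))"

definition clinear_op :: "('r::real_banach_lattice \<times> 'r \<Rightarrow> 'r \<times> 'r) \<Rightarrow> ('r \<times> 'r) set \<Rightarrow> bool" where
  "clinear_op A D \<longleftrightarrow> 0 \<in> D \<and> (\<forall>f\<in>D. \<forall>g\<in>D. f + g \<in> D \<and> A (f + g) = A f + A g)
     \<and> (\<forall>c. \<forall>f\<in>D. cscale c f \<in> D \<and> A (cscale c f) = cscale c (A f))"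

definition bounded_clinear_op :: "('r::real_banach_lattice \<times> 'r \<Rightarrow> 'r \<times> 'r) \<Rightarrow> bool" where
  "bounded_clinear_op T \<longleftrightarrow> clinear_op T UNIV \<and> (\<exists>K. \<forall>f. norm (T f) \<le> K * norm f)"

definition closed_op :: "('r::real_banach_lattice \<times> 'r \<Rightarrow> 'r \<times> 'r) \<Rightarrow> ('r \<times> 'r) set \<Rightarrow> bool" where
  "closed_op A D \<longleftrightarrow> closed {(f, A f) | f. f \<in> D}"

definition densely_defined :: "('r::real_banach_lattice \<times> 'r \<Rightarrow> 'r \<times> 'r) \<Rightarrow> ('r \<times> 'r) set \<Rightarrow> bool" where
  "densely_defined A D \<longleftrightarrow> closure D = UNIV"

definition real_op :: "('r::real_banach_lattice \<times> 'r \<Rightarrow> 'r \<times> 'r) \<Rightarrow> ('r \<times> 'r) set \<Rightarrow> bool" where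
  "real_op A D \<longleftrightarrow>
     D = {f + cscale \<i> g | f g. f \<in> D \<inter> ERe \<and> g \<in> D \<inter> ERe} \<and> (\<forall>f \<in> D \<inter> ERe. A f \<in> ERe)"

definition op_resolvent ::
  "('r::real_banach_lattice \<times> 'r \<Rightarrow> 'r \<times> 'r) \<Rightarrow> ('r \<times> 'r) set \<Rightarrow> complex \<Rightarrow> 'r \<times> 'r \<Rightarrow> 'r \<times> 'r" where
  "op_resolvent A D l f = (THE g. g \<in> D \<and> cscale l g - A g = f)"

definition resolvent_set :: "('r::real_banach_lattice \<times> 'r \<Rightarrow> 'r \<times> 'r) \<Rightarrow> ('r \<times> 'r) set \<Rightarrow> complex set" where
  "resolvent_set A D = {l. bij_betw (\<lambda>g. cscale l g - A g) D UNIV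
                          \<and> bounded_clinear_op (op_resolvent A D l)}"

definition op_spectrum :: "('r::real_banach_lattice \<times> 'r \<Rightarrow> 'r \<times> 'r) \<Rightarrow> ('r \<times> 'r) set \<Rightarrow> complex set" where
  "op_spectrum A D = - resolvent_set A D"

definition spectral_bound :: "('r::real_banach_lattice \<times> 'r \<Rightarrow> 'r \<times> 'r) \<Rightarrow> ('r \<times> 'r) set \<Rightarrow> ereal" where
  "spectral_bound A D = Sup ((\<lambda>z. ereal (Re z)) ` op_spectrum A D)"

definition is_eigenvalue :: "('r::real_banach_lattice \<times> 'r \<Rightarrow> 'r \<times> 'r) \<Rightarrow> ('r \<times> 'r) set \<Rightarrow> complex \<Rightarrow> bool" where
  "is_eigenvalue A D l \<longleftrightarrow> (\<exists>f\<in>D. f \<noteq> 0 \<and> A f = cscale l f)"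

text \<open>l0 is a pole of R(\<cdot>,A) with residue P: on a punctured disc around l0
  (contained in \<rho>(A)) the resolvent has a Laurent expansion with finite principal
  part, R(l) = \<Sum>_{j=1..k} (l-l0)^{-j} B_j + \<Sum>_{n\<ge>0} (l-l0)^n A_n
  (coefficients bounded operators), and P = B_1 is the coefficient of (l-l0)^{-1}.\<close>
definition resolvent_pole_with_residue ::
  "('r::real_banach_lattice \<times> 'r \<Rightarrow> 'r \<times> 'r) \<Rightarrow> ('r \<times> 'r) set \<Rightarrow> complex \<Rightarrow> ('r \<times> 'r \<Rightarrow> 'r \<times> 'r) \<Rightarrow> bool" where
  "resolvent_pole_with_residue A D l0 P \<longleftrightarrow>
     (\<exists>r>0. \<exists>k::nat. \<exists>a b :: nat \<Rightarrow> ('r \<times> 'r \<Rightarrow> 'r \<times> 'r).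
        (\<forall>n. bounded_clinear_op (a n)) \<and> (\<forall>j. bounded_clinear_op (b j)) \<and> P = b 1 \<and>
        (\<forall>l. 0 < cmod (l - l0) \<and> cmod (l - l0) < r \<longrightarrow>
            l \<in> resolvent_set A D \<and>
            (\<forall>f. (\<lambda>n. cscale ((l - l0) ^ n) (a n f)) sums
                   (op_resolvent A D l f - (\<Sum>j\<in>{1..k}. cscale (inverse ((l - l0) ^ j)) (b j f))))))"

definition indiv_ev_strongly_pos_at ::
  "('r::real_banach_lattice \<times> 'r \<Rightarrow> 'r \<times> 'r) \<Rightarrow> ('r \<times> 'r) set \<Rightarrow> ('r \<times> 'r) \<Rightarrow> real \<Rightarrow> bool" where
  "indiv_ev_strongly_pos_at A D u l0 \<longleftrightarrow>
     (\<exists>l2>l0. complex_of_real ` {l0<..l2} \<subseteq> resolvent_set A D \<and>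
        (\<forall>f. cstrictpos f \<longrightarrow> (\<exists>l1\<in>{l0<..l2}. \<forall>l\<in>{l0<..l1}.
            strongly_pos u (op_resolvent A D (complex_of_real l) f))))"

definition indiv_ev_strongly_neg_at ::
  "('r::real_banach_lattice \<times> 'r \<Rightarrow> 'r \<times> 'r) \<Rightarrow> ('r \<times> 'r) set \<Rightarrow> ('r \<times> 'r) \<Rightarrow> real \<Rightarrow> bool" where
  "indiv_ev_strongly_neg_at A D u l0 \<longleftrightarrow>
     (\<exists>l2<l0. complex_of_real ` {l2..<l0} \<subseteq> resolvent_set A D \<and>
        (\<forall>f. cstrictpos f \<longrightarrow> (\<exists>l1\<in>{l2..<l0}. \<forall>l\<in>{l1..<l0}.
            strongly_neg u (op_resolvent A D (complex_of_real l) f))))"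

definition indiv_ev_strongly_pos_op ::
  "('r::real_banach_lattice \<times> 'r \<Rightarrow> 'r \<times> 'r) \<Rightarrow> ('r \<times> 'r) \<Rightarrow> bool" where
  "indiv_ev_strongly_pos_op T u \<longleftrightarrow>
     (\<forall>f. cstrictpos f \<longrightarrow> (\<exists>n0::nat. \<forall>n\<ge>n0. strongly_pos u ((T ^^ n) f)))"

end

theory Submission
  imports Defs
begin

text \<open>
  By the Baire category theorem \<open>D(A) \<subseteq> E\<^sub>u\<close> gives \<open>|R(\<mu>, A) h| \<le> M \<parallel>h\<parallel> u\<close>, so norm convergence of
  vectors becomes convergence in \<open>E\<^sub>u\<close> after one application of a resolvent.

  If \<open>P\<close> is strongly positive, its range is one-dimensional, so the pole is simple; then
  \<open>z R(\<lambda>\<^sub>0 + z) f\<close> converges to \<open>P f\<close> in \<open>E\<^sub>u\<close> as \<open>z\<close> tends to 0, which yields (ii) and (iii), and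
  \<open>((\<lambda> - \<lambda>\<^sub>0) R(\<lambda>))\<^sup>n f\<close> converges to \<open>P f\<close> in \<open>E\<^sub>u\<close>, which yields (v).

  Conversely let \<open>B\<^sub>K\<close> be the Laurent coefficient of the lowest order. In (ii) and (iii) it is a limit of
  scaled resolvents; in (iv) one compares \<open>R(\<lambda>\<^sub>0 + z)\<close> with the tail of its Neumann series at \<open>\<lambda>\<close>. Hence
  \<open>B\<^sub>K\<close> is positive up to sign, it kills no positive vector, and its values are eigenvectors. But \<open>B\<^sub>K\<close>
  vanishes on eigenvectors if \<open>K \<ge> 2\<close>, so \<open>K = 1\<close>, and positive eigenvectors are strongly positive.

  No functional calculus is needed for the convergence of operator powers: the averages of
  \<open>(1 - \<omega> r S)\<inverse>\<close> over the \<open>N\<close>-th roots of unity \<open>\<omega>\<close> equal \<open>(1 - r\<^sup>N S\<^sup>N)\<inverse>\<close> and are Lipschitz in \<open>r\<close>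
  uniformly in \<open>N\<close>, so the statement that they tend to 1 propagates from \<open>r = 0\<close> to \<open>r = 1\<close>.
\<close>

section \<open>Real Banach lattices and their complexification\<close>

lemma bl_scaleR_mono:
  fixes x y :: "'r::real_banach_lattice"
  assumes "0 \<le> a" "x \<le> y" shows "a *\<^sub>R x \<le> a *\<^sub>R y"
  using scaleR_nonneg_nonneg_bl[of a "y - x"] assms
  by (simp add: scaleR_diff_right)

lemma bl_scaleR_mono_left:
  fixes x :: "'r::real_banach_lattice"
  assumes "a \<le> b" "0 \<le> x" shows "a *\<^sub>R x \<le> b *\<^sub>R x"
  using scaleR_nonneg_nonneg_bl[of "b - a" x] assms
  by (simp add: scaleR_diff_left)

lemma bl_scaleR_le_iff:
  fixes x y :: "'r::real_banach_lattice"
  assumes "0 < a" shows "a *\<^sub>R x \<le> a *\<^sub>R y \<longleftrightarrow> x \<le> y"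
proof
  assume "a *\<^sub>R x \<le> a *\<^sub>R y"
  from bl_scaleR_mono[OF _ this, of "inverse a"] assms show "x \<le> y" by simp
qed (use assms bl_scaleR_mono[of a x y] in auto)

lemma labs_ge: "x \<le> labs x" "- x \<le> labs x"
  by (simp_all add: labs_def)

lemma labs_nonneg: "0 \<le> labs x"
proof -
  have "x + - x \<le> labs x + labs x" by (intro add_mono labs_ge)
  hence "0 \<le> 2 *\<^sub>R labs x" by (simp add: scaleR_2)
  hence "0 \<le> (1/2::real) *\<^sub>R (2 *\<^sub>R labs x)" by (rule scaleR_nonneg_nonneg_bl[rotated]) simp
  thus ?thesis by (subst (asm) scaleR_scaleR) simp
qed

lemma labs_of_nonneg: "0 \<le> x \<Longrightarrow> labs x = x"
  unfolding labs_def by (rule sup_absorb1) (meson neg_le_0_iff_le order_trans)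

lemma labs_le_iff: "labs x \<le> y \<longleftrightarrow> - y \<le> x \<and> x \<le> y"
  unfolding labs_def by (auto simp: minus_le_iff)

lemma norm_labs: "norm (labs x) = norm x"
  using labs_of_nonneg[OF labs_nonneg, of x]
  by (intro antisym norm_lattice_bl) (simp_all flip: labs_def)

lemma norm_bl_mono:
  fixes x y :: "'r::real_banach_lattice"
  assumes "0 \<le> x" "x \<le> y" shows "norm x \<le> norm y"
  using norm_lattice_bl[of x y] labs_of_nonneg[of x] labs_of_nonneg[of y] assms order_trans[OF assms]
  unfolding labs_def by metis

text \<open>The negative part \<open>sup (- x) 0\<close> of a limit \<open>x\<close> of positive
  vectors \<open>f n\<close> is dominated by \<open>labs (f n - x)\<close>, so monotonicity of the
  norm forces it to vanish.\<close>

lemma closed_cone: "closed {x::'r::real_banach_lattice. 0 \<le> x}"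
  unfolding closed_sequential_limits
proof (intro allI impI, elim conjE)
  fix f :: "nat \<Rightarrow> 'r" and x
  assume pos: "\<forall>n. f n \<in> {x. 0 \<le> x}" and lim: "f \<longlonglongrightarrow> x"
  have "norm (sup (- x) 0) \<le> norm (f n - x)" for n
  proof -
    have "- x \<le> f n - x" using pos by simp
    also have "\<dots> \<le> labs (f n - x)" by (rule labs_ge)
    finally have "sup (- x) 0 \<le> labs (f n - x)" using labs_nonneg by (rule sup_least)
    thus ?thesis using norm_bl_mono[of "sup (- x) 0" "labs (f n - x)"] by (simp only: norm_labs sup_ge2)
  qed
  moreover have "(\<lambda>n. norm (f n - x)) \<longlonglongrightarrow> 0"
    using lim by (simp add: LIM_zero tendsto_norm_zero)
  ultimately have "norm (sup (- x) 0) \<le> 0"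
    by (intro LIMSEQ_le_const) auto
  hence "sup (- x) 0 = 0" by simp
  hence "- x \<le> 0" by (metis sup_ge1)
  thus "x \<in> {x. 0 \<le> x}" by simp
qed

lemma tendsto_bl_le:
  fixes f :: "'a \<Rightarrow> 'r::real_banach_lattice"
  assumes "(f \<longlongrightarrow> x) F" "F \<noteq> bot" "eventually (\<lambda>z. y \<le> f z) F"
  shows "y \<le> x"
proof -
  have "((\<lambda>z. f z - y) \<longlongrightarrow> x - y) F" by (intro tendsto_intros assms)
  hence "x - y \<in> {x. 0 \<le> x}"
    by (intro Lim_in_closed_set[OF closed_cone _ assms(2)]) (use assms(3) in simp_all)
  thus ?thesis by simp
qed

text \<open>Dividing by \<open>n\<close> bounds \<open>w\<close> by a null sequence, and order
  bounds pass to norm limits because the cone is closed.\<close>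

lemma bl_archimedean:
  fixes w v :: "'r::real_banach_lattice"
  assumes "\<And>n::nat. real n *\<^sub>R w \<le> v" shows "w \<le> 0"
proof -
  have "w \<le> (1 / real (Suc n)) *\<^sub>R v" for n
    using bl_scaleR_mono[OF _ assms, of "1 / real (Suc n)" "Suc n"] by simp
  moreover have "(\<lambda>n. (1 / real (Suc n)) *\<^sub>R v) \<longlonglongrightarrow> 0 *\<^sub>R v"
    by (intro tendsto_scaleR tendsto_const LIMSEQ_Suc[OF lim_1_over_n])
  ultimately show ?thesis using tendsto_bl_le[of _ "0 *\<^sub>R v" sequentially w] by simp
qed

section \<open>Complex scalar multiplication on pairs\<close>

lemma cscale_of_real [simp]: "cscale (complex_of_real a) f = a *\<^sub>R f"
  by (cases f) (simp add: cscale_def)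

lemma cscale_one [simp]: "cscale 1 f = f"
  by (cases f) (simp add: cscale_def)

lemma cscale_mult: "cscale (c * d) f = cscale c (cscale d f)"
  by (simp add: cscale_def algebra_simps)

lemma cscale_diff_left: "cscale (c - d) f = cscale c f - cscale d f"
  by (simp add: cscale_def algebra_simps)

lemma cscale_zero_left [simp]: "cscale 0 f = 0"
  by (simp add: cscale_def zero_prod_def)

lemma cscale_diff_right: "cscale c (f - g) = cscale c f - cscale c g"
  by (simp add: cscale_def algebra_simps)

lemma cscale_add_right: "cscale c (f + g) = cscale c f + cscale c g"
  by (simp add: cscale_def algebra_simps)

text \<open>The product norm is the Euclidean norm of the two component norms. Cauchy-Schwarz bounds
  either component by \<open>cmod c * norm f\<close>; adding the two bounds gives the factor
  2.\<close>

lemma norm_cscale: "norm (cscale c f) \<le> 2 * cmod c * norm f"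
proof -
  have a: "norm (Re c *\<^sub>R x - Im c *\<^sub>R y) \<le> cmod c * norm f"
       "norm (Im c *\<^sub>R x + Re c *\<^sub>R y) \<le> cmod c * norm f" if "f = (x, y)" for x y
  proof -
    have cs: "a * p + b * q \<le> sqrt (a\<^sup>2 + b\<^sup>2) * sqrt (p\<^sup>2 + q\<^sup>2)" for a b p q :: real
    proof -
      have "a * p + b * q \<le> sqrt ((a * p + b * q)\<^sup>2)" by simp
      also have "(a * p + b * q)\<^sup>2 \<le> (a\<^sup>2 + b\<^sup>2) * (p\<^sup>2 + q\<^sup>2)"
        using zero_le_power2[of "a * q - b * p"] by (simp add: power2_eq_square algebra_simps)
      finally show ?thesis by (simp add: real_sqrt_mult)
    qed
    have "norm (Re c *\<^sub>R x - Im c *\<^sub>R y) \<le> \<bar>Re c\<bar> * norm x + \<bar>Im c\<bar> * norm y"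
      using norm_triangle_ineq4[of "Re c *\<^sub>R x" "Im c *\<^sub>R y"] by simp
    also have "\<dots> \<le> cmod c * norm f" using cs[of "\<bar>Re c\<bar>" "norm x" "\<bar>Im c\<bar>" "norm y"]
      by (simp add: that cmod_def norm_Pair)
    finally show "norm (Re c *\<^sub>R x - Im c *\<^sub>R y) \<le> cmod c * norm f" .
    have "norm (Im c *\<^sub>R x + Re c *\<^sub>R y) \<le> \<bar>Im c\<bar> * norm x + \<bar>Re c\<bar> * norm y"
      using norm_triangle_ineq[of "Im c *\<^sub>R x" "Re c *\<^sub>R y"] by simp
    also have "\<dots> \<le> cmod c * norm f" using cs[of "\<bar>Im c\<bar>" "norm x" "\<bar>Re c\<bar>" "norm y"]
      by (simp add: that cmod_def norm_Pair add.commute)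
    finally show "norm (Im c *\<^sub>R x + Re c *\<^sub>R y) \<le> cmod c * norm f" .
  qed
  show ?thesis
    using a[of "fst f" "snd f"] norm_fst_le norm_snd_le
      sqrt_sum_squares_le_sum[of "norm (fst (cscale c f))" "norm (snd (cscale c f))"]
    by (simp add: cscale_def norm_prod_def)
qed

lemma bounded_linear_cscale [simp]: "bounded_linear (cscale c)"
  by (rule bounded_linear_intro[of _ "2 * cmod c"])
     (use norm_cscale[of c] in \<open>simp_all add: cscale_def algebra_simps\<close>)

lemma bounded_clinear_op_imp_bounded_linear:
  assumes "bounded_clinear_op T" shows "bounded_linear T"
proof -
  obtain K where K: "\<And>f. norm (T f) \<le> K * norm f" and c: "clinear_op T UNIV"
    using assms by (auto simp: bounded_clinear_op_def)
  have "T (a *\<^sub>R f) = a *\<^sub>R T f" for a f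
    using c unfolding clinear_op_def by (metis UNIV_I cscale_of_real)
  with c show ?thesis
    by (intro bounded_linear_intro[of _ K]) (use K in \<open>auto simp: clinear_op_def mult.commute\<close>)
qed

lemma bounded_clinear_op_cscale:
  "bounded_clinear_op T \<Longrightarrow> T (cscale c f) = cscale c (T f)"
  unfolding bounded_clinear_op_def clinear_op_def by blast

text \<open>A uniform boundedness principle: the closed sets on which \<open>T h\<close> lies
  between \<open>- n u\<close> and \<open>n u\<close> cover the space, so by Baire one of them
  contains a ball. Differences carry the bound to a ball around 0, and homogeneity carries it to all
  vectors.\<close>

lemma linear_le_unit_bounded:
  fixes T :: "'r::real_banach_lattice \<Rightarrow> 'r" and u :: 'r
  assumes T: "bounded_linear T" and u: "0 \<le> u"
    and fin: "\<And>h. \<exists>c\<ge>0. labs (T h) \<le> c *\<^sub>R u"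
  shows "\<exists>M\<ge>0. \<forall>h. labs (T h) \<le> (M * norm h) *\<^sub>R u"
proof -
  interpret bounded_linear T by fact
  let ?C = "\<lambda>n::nat. {h. - (real n *\<^sub>R u) \<le> T h \<and> T h \<le> real n *\<^sub>R u}"
  have cl: "closed (?C n)" for n
  proof -
    have "?C n = (\<lambda>h. T h + real n *\<^sub>R u) -` {x. 0 \<le> x} \<inter> (\<lambda>h. real n *\<^sub>R u - T h) -` {x. 0 \<le> x}"
      by (auto simp: neg_le_iff_le diff_le_eq add.commute)
         (metis diff_0 diff_le_eq)+
    moreover have "isCont T h" for h using T by (rule linear_continuous_at)
    ultimately show ?thesis
      by (simp only:, intro closed_Int continuous_closed_vimage[OF closed_cone] continuous_intros)
  qed
  have un: "(\<Union>n. ?C n) = UNIV"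
  proof (intro set_eqI iffI UNIV_I)
    fix h
    obtain c where c: "c \<ge> 0" "labs (T h) \<le> c *\<^sub>R u" using fin by blast
    have "labs (T h) \<le> real (nat \<lceil>c\<rceil>) *\<^sub>R u"
      using c bl_scaleR_mono_left[of c "real (nat \<lceil>c\<rceil>)" u] u by (meson of_nat_ceiling order_trans)
    thus "h \<in> (\<Union>n. ?C n)" by (auto simp: labs_le_iff)
  qed
  have "\<exists>n. interior (?C n) \<noteq> {}"
  proof (rule ccontr)
    assume "\<not> ?thesis"
    hence e: "interior (?C n) = {}" for n by blast
    have "Met_TC.mtopology interior_of \<Union>(range ?C) = {}"
    proof (rule Met_TC.metric_Baire_category_alt)
      show "Met_TC.mcomplete TYPE('r)" by (simp add: complete_UNIV)
    qed (use cl e in \<open>auto simp: interior_of_def interior_def\<close>)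
    thus False using un interior_of_topspace[of "euclidean :: 'r topology"] by simp
  qed
  then obtain n y where "y \<in> interior (?C n)" by blast
  then obtain e where e: "0 < e" "cball y e \<subseteq> ?C n"
    unfolding mem_interior_cball by blast
  \<comment> \<open>The ball is centred at \<open>y\<close>; writing \<open>T h\<close> as
    \<open>T (y + h) - T y\<close> moves it to the origin at the cost of doubling the bound.\<close>
  have small: "labs (T h) \<le> (2 * real n) *\<^sub>R u" if "norm h \<le> e" for h
  proof -
    have "y + h \<in> ?C n" "y \<in> ?C n"
      using e that by (auto simp: subset_iff dist_norm)
    hence "- (real n *\<^sub>R u) - real n *\<^sub>R u \<le> T (y + h) - T y" "T (y + h) - T y \<le> real n *\<^sub>R u - - (real n *\<^sub>R u)"
      using diff_mono[of "- (real n *\<^sub>R u)" "T (y + h)" "T y" "real n *\<^sub>R u"]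
        diff_mono[of "T (y + h)" "real n *\<^sub>R u" "- (real n *\<^sub>R u)" "T y"] by blast+
    thus ?thesis
      using scaleR_2[of "real n *\<^sub>R u"] by (simp add: labs_le_iff add)
  qed
  have "labs (T h) \<le> (2 * real n / e * norm h) *\<^sub>R u" for h
  proof (cases "h = 0")
    case True thus ?thesis by (simp add: labs_def zero)
  next
    case False
    define s where "s = e / norm h"
    have s: "s > 0" using False e by (simp add: s_def)
    have "labs (T (s *\<^sub>R h)) \<le> (2 * real n) *\<^sub>R u" by (rule small) (use False e in \<open>simp add: s_def\<close>)
    hence "s *\<^sub>R (- ((2 * real n / s) *\<^sub>R u)) \<le> s *\<^sub>R T h \<and> s *\<^sub>R T h \<le> s *\<^sub>R ((2 * real n / s) *\<^sub>R u)"
      using s by (simp add: labs_le_iff scaleR)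
    hence "labs (T h) \<le> (2 * real n / s) *\<^sub>R u"
      unfolding bl_scaleR_le_iff[OF s] labs_le_iff .
    thus ?thesis by (simp add: s_def)
  qed
  thus ?thesis using e by (intro exI[of _ "2 * real n / e"]) auto
qed

section \<open>Powers of operators without spectrum outside the open unit disc\<close>

lemma bounded_linear_funpow:
  fixes S :: "'a::real_normed_vector \<Rightarrow> 'a"
  assumes "bounded_linear S" shows "bounded_linear (S ^^ n)"
  by (induction n) (use assms in \<open>simp_all add: id_def bounded_linear_ident o_def bounded_linear_compose\<close>)

text \<open>Swapping the roles of \<open>j\<close> and \<open>k\<close> turns this into a geometric
  sum whose ratio is an \<open>N\<close>-th root of unity different from 1.\<close>

lemma sum_roots_of_unity_power:
  assumes "0 < j" "j < N"
  shows "(\<Sum>k<N. exp (2 * complex_of_real pi * \<i> * of_nat k / of_nat N) ^ j) = 0"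
proof -
  let ?x = "exp (2 * complex_of_real pi * \<i> * of_nat j / of_nat N)"
  have "exp (2 * complex_of_real pi * \<i> * of_nat k / of_nat N) ^ j = ?x ^ k" for k
    by (simp flip: exp_of_nat_mult) (simp add: mult_ac)
  moreover have "?x \<noteq> 1"
    using assms complex_root_unity_eq_1[of N j] by (auto dest: dvd_imp_le)
  moreover have "?x ^ N = 1" using assms complex_root_unity[of N j] by simp
  ultimately show ?thesis by (simp add: geometric_sum)
qed

text \<open>\<open>F z\<close> is the two-sided inverse of \<open>1 - z S\<close> on the closed unit
  disc, so the assumptions say that the spectrum of \<open>S\<close> lies in the open unit disc.
  Boundedness is assumed for each \<open>z\<close> separately; uniformity in \<open>z\<close> is
  derived.\<close>

locale power_bounded_resolvent =
  fixes S :: "'r::real_banach_lattice \<times> 'r \<Rightarrow> 'r \<times> 'r" and F :: "complex \<Rightarrow> 'r \<times> 'r \<Rightarrow> 'r \<times> 'r"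
  assumes S: "bounded_clinear_op S"
    and F: "cmod z \<le> 1 \<Longrightarrow> bounded_linear (F z)"
    and left: "cmod z \<le> 1 \<Longrightarrow> F z (g - cscale z (S g)) = g"
    and right: "cmod z \<le> 1 \<Longrightarrow> F z g - cscale z (S (F z g)) = g"
begin

sublocale S: bounded_linear S by (rule bounded_clinear_op_imp_bounded_linear[OF S])

lemma S_cscale: "S (cscale c f) = cscale c (S f)"
  by (rule bounded_clinear_op_cscale[OF S])

lemma S_bound: "\<exists>K>0. \<forall>h. norm (S h) \<le> K * norm h"
  using S.pos_bounded by (simp add: mult.commute)

text \<open>A perturbation argument bounds \<open>F\<close> near each point of the disc, and
  finitely many of these neighbourhoods cover the disc by compactness.\<close>

lemma uniform_bound: "\<exists>M>0. \<forall>z g. cmod z \<le> 1 \<longrightarrow> norm (F z g) \<le> M * norm g"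
proof -
  obtain K where K: "K > 0" "\<And>h. norm (S h) \<le> K * norm h" using S_bound by blast
  have "\<exists>m>0. \<forall>g. norm (F z g) \<le> m * norm g" if "cmod z \<le> 1" for z
    using bounded_linear.pos_bounded[OF F[OF that]] by (simp add: mult.commute)
  then obtain m where m: "\<And>z. cmod z \<le> 1 \<Longrightarrow> m z > 0"
      "\<And>z g. cmod z \<le> 1 \<Longrightarrow> norm (F z g) \<le> m z * norm g" by metis
  \<comment> \<open>This radius makes the perturbation term
    \<open>m z * (2 * e z * K * norm h)\<close> equal to \<open>norm h / 2\<close>, which can be
    absorbed on the left.\<close>
  define e where "e z = 1 / (4 * m z * K)" for z
  have loc: "norm (F w g) \<le> 2 * m z * norm g" if z: "cmod z \<le> 1" and w: "cmod w \<le> 1" and d: "cmod (w - z) < e z" for z w g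
  proof -
    interpret Fz: bounded_linear "F z" by (rule F[OF z])
    define h where "h = F w g"
    have "h - cscale z (S h) = g + cscale (w - z) (S h)"
      using right[OF w, of g] by (simp add: h_def cscale_diff_left algebra_simps)
    hence "h = F z (g + cscale (w - z) (S h))" using left[OF z, of h] by simp
    hence "norm h \<le> m z * norm (g + cscale (w - z) (S h))" using m(2)[OF z] by metis
    also have "\<dots> \<le> m z * (norm g + 2 * e z * (K * norm h))"
      using z m(1)[OF z] d K less_imp_le[OF le_less_trans[OF norm_ge_zero d]]
      by (intro mult_left_mono order_trans[OF norm_triangle_ineq] add_left_mono
            order_trans[OF norm_cscale] mult_mono) auto
    also have "\<dots> = m z * norm g + norm h / 2"
      using m(1)[OF z] K by (simp add: e_def field_simps)
    finally show ?thesis by (simp add: h_def)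
  qed
  have "compact (cball (0::complex) 1)" by simp
  then obtain T where T: "T \<subseteq> cball 0 1" "finite T" "cball (0::complex) 1 \<subseteq> (\<Union>z\<in>T. ball z (e z))"
  proof (rule compactE_image[of _ "cball 0 1" "\<lambda>z. ball z (e z)"])
    show "cball (0::complex) 1 \<subseteq> (\<Union>z\<in>cball 0 1. ball z (e z))"
      using m(1) K by (auto simp: e_def intro!: bexI)
  qed auto
  define M where "M = (\<Sum>z\<in>T. 2 * m z) + 1"
  have nn: "0 \<le> (\<Sum>z\<in>T. 2 * m z)" using T m(1) by (intro sum_nonneg) (auto simp: subset_iff intro: less_imp_le)
  have "norm (F w g) \<le> M * norm g" if w: "cmod w \<le> 1" for w g
  proof -
    obtain z where z: "z \<in> T" "cmod (w - z) < e z" using T(3) w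
      by (auto simp: subset_iff dist_norm norm_minus_commute)
    hence z1: "cmod z \<le> 1" using T by (auto simp: subset_iff)
    have "2 * m z \<le> M" unfolding M_def
      using member_le_sum[of z T "\<lambda>z. 2 * m z"] z T m(1) by (force simp: subset_iff intro: less_imp_le)
    with loc[OF z1 w z(2), of g] show ?thesis
      by (meson mult_right_mono norm_ge_zero order_trans)
  qed
  thus ?thesis using nn by (intro exI[of _ M]) (auto simp: M_def)
qed

text \<open>For a scalar in place of \<open>S\<close> this is the partial fraction decomposition of
  \<open>1 / (1 - r^N S^N)\<close>; \<open>avg_left\<close> and \<open>avg_right\<close> express
  that \<open>avg N r\<close> inverts the operator \<open>1 - r^N S^N\<close>.\<close>

definition avg :: "nat \<Rightarrow> real \<Rightarrow> 'r \<times> 'r \<Rightarrow> 'r \<times> 'r" where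
  "avg N r g = (1 / real N) *\<^sub>R
     (\<Sum>k<N. F (complex_of_real r * exp (2 * complex_of_real pi * \<i> * of_nat k / of_nat N)) g)"

lemma cmod_point: "0 \<le> r \<Longrightarrow> cmod (complex_of_real r * exp (2 * complex_of_real pi * \<i> * of_nat k / of_nat N)) = r"
  by (simp add: norm_mult)

text \<open>The finite geometric sum is mapped by \<open>1 - z S\<close> to
  \<open>g - z^N S^N g\<close> by telescoping; applying \<open>F z\<close> undoes this.\<close>

lemma F_geometric:
  assumes "cmod z \<le> 1"
  shows "F z (g - cscale (z ^ N) ((S ^^ N) g)) = (\<Sum>j<N. cscale (z ^ j) ((S ^^ j) g))"
proof -
  let ?p = "\<Sum>j<N. cscale (z ^ j) ((S ^^ j) g)"
  have "cscale z (S ?p) = (\<Sum>j<N. cscale (z ^ Suc j) ((S ^^ Suc j) g))"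
    by (simp add: S.sum S_cscale linear_sum[OF bounded_linear.linear[OF bounded_linear_cscale]] cscale_mult)
  hence "?p - cscale z (S ?p) = g - cscale (z ^ N) ((S ^^ N) g)"
    using sum_lessThan_telescope'[of "\<lambda>j. cscale (z ^ j) ((S ^^ j) g)" N]
    by (simp add: sum_subtractf)
  thus ?thesis using left[OF assms, of ?p] by simp
qed

lemma F_comm_S: "cmod z \<le> 1 \<Longrightarrow> F z (S g) = S (F z g)"
  using left[of z "S (F z g)"] arg_cong[OF right[of z g], of S] by (simp add: S_cscale S.diff)

lemma F_comm_S_pow: "cmod z \<le> 1 \<Longrightarrow> F z ((S ^^ n) g) = (S ^^ n) (F z g)"
  by (induction n) (simp_all add: F_comm_S)

text \<open>At each point \<open>r w\<close> with \<open>w^N = 1\<close> the value of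
  \<open>F\<close> is the geometric sum of \<open>F_geometric\<close>. Averaging over the roots of
  unity kills every term except the one with \<open>j = 0\<close>.\<close>

lemma avg_left:
  assumes r: "0 \<le> r" "r \<le> 1" and N: "N > 0"
  shows "avg N r (g - (r ^ N) *\<^sub>R (S ^^ N) g) = g"
proof -
  let ?w = "\<lambda>k. exp (2 * complex_of_real pi * \<i> * of_nat k / of_nat N)"
  have wN: "?w k ^ N = 1" for k using complex_root_unity[of N k] N by simp
  have "F (of_real r * ?w k) (g - (r ^ N) *\<^sub>R (S ^^ N) g)
      = (\<Sum>j<N. cscale ((of_real r * ?w k) ^ j) ((S ^^ j) g))" for k
    using F_geometric[of "of_real r * ?w k" g N] cmod_point[OF r(1)] r
    by (simp add: power_mult_distrib wN flip: of_real_power)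
  hence "avg N r (g - (r ^ N) *\<^sub>R (S ^^ N) g)
      = (1 / real N) *\<^sub>R (\<Sum>j<N. \<Sum>k<N. cscale ((of_real r * ?w k) ^ j) ((S ^^ j) g))"
    unfolding avg_def by (simp only:) (subst sum.swap, rule refl)
  also have "(\<Sum>k<N. cscale ((of_real r * ?w k) ^ j) ((S ^^ j) g)) = (if j = 0 then real N *\<^sub>R g else 0)"
    if "j < N" for j
  proof (cases "j = 0")
    case True thus ?thesis by (simp add: scaleR_conv_of_real sum_constant_scaleR)
  next
    case False
    have "(\<Sum>k<N. cscale ((of_real r * ?w k) ^ j) h) = cscale (of_real r ^ j * (\<Sum>k<N. ?w k ^ j)) h" for h
      by (simp add: cscale_def power_mult_distrib sum_distrib_left prod_eq_iff fst_sum snd_sum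
           sum_subtractf sum.distrib scaleR_sum_left)
    thus ?thesis using sum_roots_of_unity_power[of j N] False that by simp
  qed
  hence "(\<Sum>j<N. \<Sum>k<N. cscale ((of_real r * ?w k) ^ j) ((S ^^ j) g)) = real N *\<^sub>R g"
    using N by simp
  finally show ?thesis using N by simp
qed

lemma avg_linear: "\<lbrakk>0 \<le> r; r \<le> 1\<rbrakk> \<Longrightarrow> linear (avg N r)"
  unfolding avg_def
  by (intro linear_compose_scale_right linear_compose_sum ballI bounded_linear.linear F) (simp add: cmod_point)

lemma avg_diff: "\<lbrakk>0 \<le> r; r \<le> 1\<rbrakk> \<Longrightarrow> avg N r (f - g) = avg N r f - avg N r g"
  by (rule linear_diff[OF avg_linear])

lemma avg_scale: "\<lbrakk>0 \<le> r; r \<le> 1\<rbrakk> \<Longrightarrow> avg N r (c *\<^sub>R g) = c *\<^sub>R avg N r g"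
  by (rule linear_scale[OF avg_linear])

lemma avg_S_pow:
  assumes "0 \<le> r" "r \<le> 1" shows "avg N r ((S ^^ n) g) = (S ^^ n) (avg N r g)"
proof -
  interpret bounded_linear "S ^^ n" by (rule bounded_linear_funpow) unfold_locales
  show ?thesis by (simp add: avg_def scaleR sum F_comm_S_pow cmod_point assms)
qed

lemma avg_right:
  assumes "0 \<le> r" "r \<le> 1" "N > 0"
  shows "avg N r g - g = (r ^ N) *\<^sub>R (S ^^ N) (avg N r g)"
  using avg_left[OF assms, of g] by (simp add: avg_diff avg_scale avg_S_pow assms algebra_simps)

lemma avg_bound:
  assumes M: "\<And>z g. cmod z \<le> 1 \<Longrightarrow> norm (F z g) \<le> M * norm g" and r: "0 \<le> r" "r \<le> 1" and N: "N > 0"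
  shows "norm (avg N r g) \<le> M * norm g"
proof -
  have "norm (\<Sum>k<N. F (complex_of_real r * exp (2 * complex_of_real pi * \<i> * of_nat k / of_nat N)) g)
      \<le> real N * (M * norm g)"
    using sum_norm_bound[of "{..<N}" "\<lambda>k. F (complex_of_real r * exp (2 * complex_of_real pi * \<i> * of_nat k / of_nat N)) g" "M * norm g"]
    by (simp add: M cmod_point r)
  thus ?thesis using N by (simp add: avg_def divide_simps mult.commute)
qed

text \<open>\<open>F z - F w = (z - w) F z S F w\<close> makes \<open>F\<close> Lipschitz. An
  average inherits the constant, so it does not depend on \<open>N\<close>.\<close>

lemma avg_lipschitz:
  "\<exists>L>0. \<forall>N>0. \<forall>r r' g. 0 \<le> r \<longrightarrow> r \<le> 1 \<longrightarrow> 0 \<le> r' \<longrightarrow> r' \<le> 1 \<longrightarrow>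
      norm (avg N r g - avg N r' g) \<le> L * \<bar>r - r'\<bar> * norm g"
proof -
  obtain K where K: "K > 0" "\<And>h. norm (S h) \<le> K * norm h" using S_bound by blast
  obtain M where M: "M > 0" "\<And>z g. cmod z \<le> 1 \<Longrightarrow> norm (F z g) \<le> M * norm g" using uniform_bound by blast
  \<comment> \<open>One factor \<open>M\<close> for each of the two inverses, \<open>K\<close> for
    \<open>S\<close>, and 2 from \<open>norm_cscale\<close>.\<close>
  define L where "L = 2 * K * M\<^sup>2"
  have lip: "norm (F z g - F w g) \<le> L * cmod (z - w) * norm g" if z: "cmod z \<le> 1" and w: "cmod w \<le> 1" for z w g
  proof -
    interpret Fz: bounded_linear "F z" by (rule F[OF z])
    have "F w g - cscale z (S (F w g)) = g - cscale (z - w) (S (F w g))"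
      using right[OF w, of g] by (simp add: cscale_diff_left algebra_simps)
    hence "F w g = F z (g - cscale (z - w) (S (F w g)))"
      using left[OF z, of "F w g"] by simp
    hence "F z g - F w g = F z (cscale (z - w) (S (F w g)))"
      by (simp only: Fz.diff) (simp add: algebra_simps)
    hence "norm (F z g - F w g) \<le> M * norm (cscale (z - w) (S (F w g)))"
      using M(2)[OF z] by simp
    also have "\<dots> \<le> M * (2 * cmod (z - w) * (K * (M * norm g)))"
      using M K by (intro mult_left_mono order_trans[OF norm_cscale]
          order_trans[OF K(2)] M(2) w) auto
    finally show ?thesis by (simp add: L_def power2_eq_square mult_ac)
  qed
  have "norm (avg N r g - avg N r' g) \<le> L * \<bar>r - r'\<bar> * norm g"
    if "N > 0" and r: "0 \<le> r" "r \<le> 1" "0 \<le> r'" "r' \<le> 1" for N r r' g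
  proof -
    let ?w = "\<lambda>k. exp (2 * complex_of_real pi * \<i> * of_nat k / of_nat N)"
    have d: "cmod (complex_of_real r * ?w k - complex_of_real r' * ?w k) = \<bar>r - r'\<bar>" for k
      by (simp add: norm_mult flip: left_diff_distrib of_real_diff)
    have lipk: "norm (F (complex_of_real r * ?w k) g - F (complex_of_real r' * ?w k) g) \<le> L * \<bar>r - r'\<bar> * norm g" for k
      using lip[of "complex_of_real r * ?w k" "complex_of_real r' * ?w k" g] unfolding d
      by (simp only: cmod_point r)
    have "norm (\<Sum>k<N. F (complex_of_real r * ?w k) g - F (complex_of_real r' * ?w k) g)
       \<le> real N * (L * \<bar>r - r'\<bar> * norm g)"
      using sum_norm_bound[of "{..<N}" "\<lambda>k. F (complex_of_real r * ?w k) g - F (complex_of_real r' * ?w k) g" "L * \<bar>r - r'\<bar> * norm g"]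
        lipk by simp
    moreover have "avg N r g - avg N r' g = (1 / real N) *\<^sub>R (\<Sum>k<N. F (complex_of_real r * ?w k) g - F (complex_of_real r' * ?w k) g)"
      by (simp add: avg_def sum_subtractf scaleR_diff_right)
    ultimately show ?thesis using \<open>N > 0\<close> by (simp add: divide_simps mult.commute)
  qed
  moreover have "L > 0" using K M by (simp add: L_def)
  ultimately show ?thesis by blast
qed

text \<open>Convergence to the identity in operator norm: the threshold for \<open>N\<close> is the
  same for all \<open>g\<close>.\<close>

definition avg_conv :: "real \<Rightarrow> bool" where
  "avg_conv r \<longleftrightarrow> (\<forall>e>0. \<forall>\<^sub>F N in sequentially. \<forall>g. norm (avg N r g - g) \<le> e * norm g)"

text \<open>By \<open>avg_left\<close>, an average close to the identity forces its inverse \<open>1 - r\<^sup>N S\<^sup>N\<close> to be close to the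
  identity too.\<close>

lemma power_bound_of_avg:
  assumes r: "0 \<le> r" "r \<le> 1" and N: "N > 0" and e: "0 \<le> e" "e \<le> 1/2"
    and a: "\<And>g. norm (avg N r g - g) \<le> e * norm g"
  shows "norm ((r ^ N) *\<^sub>R (S ^^ N) g) \<le> 2 * e * norm g"
proof -
  define y where "y = g - (r ^ N) *\<^sub>R (S ^^ N) g"
  have "norm (g - y) \<le> e * norm y" using a[of y] avg_left[OF r N, of g] by (simp add: y_def)
  moreover have "norm y \<le> norm g + norm (g - y)" using norm_triangle_ineq4[of g "g - y"] by simp
  moreover have "e * norm y \<le> norm y / 2" using e mult_right_mono[of e "1/2" "norm y"] by simp
  ultimately have "norm y \<le> 2 * norm g" by linarith
  with e(1) have "e * norm y \<le> e * (2 * norm g)" by (rule mult_left_mono[rotated])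
  with \<open>norm (g - y) \<le> e * norm y\<close> show ?thesis by (simp add: y_def)
qed

lemma avg_conv_zero: "avg_conv 0"
proof -
  have "avg N 0 g = g" if "N > 0" for N g
    using avg_left[of 0 N g] that by (simp add: power_0_left)
  thus ?thesis unfolding avg_conv_def
    by (intro allI impI eventually_mono[OF eventually_gt_at_top[of 0]]) auto
qed

text \<open>At a radius \<open>s\<close> slightly beyond \<open>r'\<close> the Lipschitz bound keeps
  the averages within 1/2 of the identity, so \<open>s^N S^N\<close> stays bounded. Passing back to
  \<open>r' < s\<close> gains the null factor \<open>(r' / s)^N\<close>. The step length
  \<open>d\<close> works for every starting radius.\<close>

lemma avg_conv_step:
  "\<exists>d>0. \<forall>r r'. 0 \<le> r \<longrightarrow> avg_conv r \<longrightarrow> r \<le> r' \<longrightarrow> r' < 1 \<longrightarrow> r' \<le> r + d \<longrightarrow> avg_conv r'"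
proof -
  obtain M where M: "M > 0" "\<And>z g. cmod z \<le> 1 \<Longrightarrow> norm (F z g) \<le> M * norm g" using uniform_bound by blast
  obtain L where L: "L > 0" "\<And>N r r' g. N > 0 \<Longrightarrow> 0 \<le> r \<Longrightarrow> r \<le> 1 \<Longrightarrow> 0 \<le> r' \<Longrightarrow> r' \<le> 1 \<Longrightarrow>
      norm (avg N r g - avg N r' g) \<le> L * \<bar>r - r'\<bar> * norm g" using avg_lipschitz by metis
  \<comment> \<open>Now \<open>L * d = 1/4\<close>, which together with the 1/4 from convergence at
    \<open>r\<close> gives the 1/2 required by \<open>power_bound_of_avg\<close>.\<close>
  define d where "d = 1 / (4 * L)"
  have d: "d > 0" using L by (simp add: d_def)
  have "avg_conv r'" if r: "0 \<le> r" "avg_conv r" "r \<le> r'" "r' < 1" "r' \<le> r + d / 2" for r r'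
    unfolding avg_conv_def
  proof (intro allI impI)
    fix e :: real assume e: "e > 0"
    \<comment> \<open>The cap at 1 stays inside the closed disc on which \<open>F\<close> is
      controlled; \<open>r' < s\<close> because \<open>r' < 1\<close> and
      \<open>r' \<le> r + d / 2\<close>.\<close>
    define s where "s = min 1 (r + d)"
    have s: "r' < s" "s \<le> 1" "r \<le> s" "s \<le> r + d" "0 < s" using r d by (auto simp: s_def)
    have "\<forall>\<^sub>F N in sequentially. (r' / s) ^ N * M < e"
    proof (rule order_tendstoD)
      have "(\<lambda>N. (r' / s) ^ N * M) \<longlonglongrightarrow> 0 * M"
        using s r by (intro tendsto_mult tendsto_const LIMSEQ_power_zero) auto
      thus "(\<lambda>N. (r' / s) ^ N * M) \<longlonglongrightarrow> 0" by simp
    qed (use e in auto)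
    moreover have "\<forall>\<^sub>F N in sequentially. \<forall>g. norm (avg N r g - g) \<le> (1/4) * norm g"
      using r(2) unfolding avg_conv_def by (auto elim!: allE[of _ "1/4"])
    ultimately show "\<forall>\<^sub>F N in sequentially. \<forall>g. norm (avg N r' g - g) \<le> e * norm g"
      using eventually_gt_at_top[of 0]
    proof eventually_elim
      case (elim N)
      have "norm (avg N s g - g) \<le> (1/2) * norm g" for g
      proof -
        have "norm (avg N s g - avg N r g) \<le> L * \<bar>s - r\<bar> * norm g" using elim s r by (intro L) auto
        also have "\<dots> \<le> L * d * norm g" using L s by (intro mult_right_mono mult_left_mono) auto
        also have "\<dots> = (1/4) * norm g" using L by (simp add: d_def)
        finally show ?thesis using elim(2)[rule_format, of g]
          norm_triangle_ineq[of "avg N s g - avg N r g" "avg N r g - g"] by simp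
      qed
      hence b: "norm ((s ^ N) *\<^sub>R (S ^^ N) g) \<le> norm g" for g
        using power_bound_of_avg[of s N "1/2" g] s elim by auto
      show ?case
      proof
        fix g
        have "avg N r' g - g = ((r' / s) ^ N) *\<^sub>R ((s ^ N) *\<^sub>R (S ^^ N) (avg N r' g))"
          using avg_right[of r' N g] r s elim by (simp add: power_divide)
        hence "norm (avg N r' g - g) \<le> (r' / s) ^ N * norm (avg N r' g)"
          using b[of "avg N r' g"] r s by (simp only: norm_scaleR) (intro mult_mono; simp)
        also have "\<dots> \<le> (r' / s) ^ N * (M * norm g)"
          using r s elim M by (intro mult_left_mono avg_bound) auto
        also have "\<dots> \<le> e * norm g" using elim(1) mult_right_mono[of "(r' / s) ^ N * M" e "norm g"] by (simp add: mult_ac)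
        finally show "norm (avg N r' g - g) \<le> e * norm g" .
      qed
    qed
  qed
  thus ?thesis using d by (intro exI[of _ "d/2"]) auto
qed

text \<open>Finitely many steps of length \<open>d\<close> lead from 0 to any radius below 1. The
  endpoint 1 is then reached by the Lipschitz bound, which is uniform in \<open>N\<close>.\<close>

lemma avg_conv_one: "avg_conv 1"
proof -
  obtain d where d: "d > 0" "\<And>r r'. 0 \<le> r \<Longrightarrow> avg_conv r \<Longrightarrow> r \<le> r' \<Longrightarrow> r' < 1 \<Longrightarrow> r' \<le> r + d \<Longrightarrow> avg_conv r'"
    using avg_conv_step by blast
  have *: "avg_conv r" if "0 \<le> r" "r < 1" "r \<le> real n * d" for r n
    using that
  proof (induction n arbitrary: r)
    case 0
    hence "r = 0" by simp
    thus ?case using avg_conv_zero by simp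
  next
    case (Suc n)
    show ?case
    proof (cases "r \<le> real n * d")
      case True
      with Suc.prems show ?thesis by (intro Suc.IH)
    next
      case False
      have "0 \<le> real n * d" using d(1) by simp
      moreover from this False Suc.prems have "avg_conv (real n * d)" by (intro Suc.IH) linarith+
      ultimately show ?thesis
        by (rule d(2)) (use False Suc.prems in \<open>simp_all add: algebra_simps\<close>)
    qed
  qed
  have lt: "avg_conv r" if "0 \<le> r" "r < 1" for r
    using *[OF that, of "nat \<lceil>r / d\<rceil>"] d(1) real_nat_ceiling_ge[of "r / d"] by (simp add: field_simps)
  obtain L where L: "L > 0" "\<And>N r r' g. N > 0 \<Longrightarrow> 0 \<le> r \<Longrightarrow> r \<le> 1 \<Longrightarrow> 0 \<le> r' \<Longrightarrow> r' \<le> 1 \<Longrightarrow>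
      norm (avg N r g - avg N r' g) \<le> L * \<bar>r - r'\<bar> * norm g" using avg_lipschitz by metis
  show ?thesis unfolding avg_conv_def
  proof (intro allI impI)
    fix e :: real assume e: "e > 0"
    define r where "r = max 0 (1 - e / (2 * L))"
    have r: "0 \<le> r" "r < 1" using e L by (auto simp: r_def)
    have "1 - r \<le> e / (2 * L)" by (auto simp: r_def)
    hence rL: "L * \<bar>1 - r\<bar> \<le> e / 2" using r L by (simp add: field_simps)
    have "\<forall>\<^sub>F N in sequentially. \<forall>g. norm (avg N r g - g) \<le> (e/2) * norm g"
      using lt[OF r] e unfolding avg_conv_def by (auto elim!: allE[of _ "e/2"])
    thus "\<forall>\<^sub>F N in sequentially. \<forall>g. norm (avg N 1 g - g) \<le> e * norm g"
      using eventually_gt_at_top[of 0]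
    proof eventually_elim
      case (elim N)
      show ?case
      proof
        fix g
        have "norm (avg N 1 g - avg N r g) \<le> L * \<bar>1 - r\<bar> * norm g" using elim r by (intro L) auto
        also have "\<dots> \<le> (e/2) * norm g" using rL by (rule mult_right_mono) simp
        finally show "norm (avg N 1 g - g) \<le> e * norm g"
          using elim(1)[rule_format, of g] norm_triangle_ineq[of "avg N 1 g - avg N r g" "avg N r g - g"] by simp
      qed
    qed
  qed
qed

theorem powers_tendsto_zero: "(\<lambda>n. (S ^^ n) g) \<longlonglongrightarrow> 0"
proof (rule tendstoI)
  fix e :: real assume e: "e > 0"
  \<comment> \<open>The first bound is required by \<open>power_bound_of_avg\<close>, the second
    makes \<open>2 * e' * norm g\<close> smaller than \<open>e\<close>; the added 1 covers
    \<open>g = 0\<close>.\<close>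
  define e' where "e' = min (1/2) (e / (4 * (norm g + 1)))"
  have e': "e' > 0" "e' \<le> 1/2" "e' * (norm g + 1) \<le> e / 4"
  proof -
    show "e' > 0" using e by (simp add: e'_def add_nonneg_pos)
    show "e' \<le> 1/2" unfolding e'_def by (rule min.cobounded1)
    have "e' * (norm g + 1) \<le> (e / (4 * (norm g + 1))) * (norm g + 1)"
      by (rule mult_right_mono) (auto simp: e'_def)
    also have "\<dots> = e / 4" using norm_ge_zero[of g] by (simp add: divide_simps) (use norm_ge_zero[of g] in linarith)
    finally show "e' * (norm g + 1) \<le> e / 4" .
  qed
  have "\<forall>\<^sub>F N in sequentially. \<forall>g. norm (avg N 1 g - g) \<le> e' * norm g"
    using avg_conv_one e' unfolding avg_conv_def by blast
  thus "\<forall>\<^sub>F n in sequentially. dist ((S ^^ n) g) 0 < e"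
    using eventually_gt_at_top[of 0]
  proof eventually_elim
    case (elim N)
    have "norm ((S ^^ N) g) \<le> 2 * e' * norm g"
      using power_bound_of_avg[of 1 N e' g] elim e' by simp
    also have "\<dots> \<le> 2 * (e' * (norm g + 1))" using e' by (simp add: algebra_simps)
    also have "\<dots> < e" using e' e by linarith
    finally show ?case by simp
  qed
qed

end

section \<open>Laurent expansions of resolvents along the real axis\<close>

text \<open>Records only the coefficients of negative order and the constant term, along real
  \<open>z\<close>, as a limit at 0. Here \<open>k\<close> is merely an upper bound for the order of
  the pole.\<close>

definition has_principal_part ::
  "nat \<Rightarrow> (nat \<Rightarrow> 'a::real_normed_vector) \<Rightarrow> 'a \<Rightarrow> (real \<Rightarrow> 'a) \<Rightarrow> bool" where
  "has_principal_part k c h f \<longleftrightarrow>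
     ((\<lambda>z. f z - (\<Sum>j=1..k. inverse (z ^ j) *\<^sub>R c j)) \<longlongrightarrow> h) (at 0)"

lemma eventually_at_neq_real: "\<forall>\<^sub>F z in at (0::real). z \<noteq> 0"
  by (simp add: eventually_at_filter)

text \<open>Multiplying by \<open>z ^ Suc k\<close> isolates the coefficient of lowest order, which
  must vanish; induction removes the others.\<close>

lemma principal_part_zero:
  fixes c :: "nat \<Rightarrow> 'a::real_normed_vector"
  assumes "((\<lambda>z. \<Sum>j=1..k. inverse (z ^ j) *\<^sub>R c j) \<longlongrightarrow> h) (at (0::real))"
  shows "h = 0 \<and> (\<forall>j\<in>{1..k}. c j = 0)"
  using assms
proof (induction k)
  case 0
  thus ?case by (simp add: tendsto_const_iff)
next
  case (Suc k)
  have "((\<lambda>z. z ^ Suc k *\<^sub>R (\<Sum>j=1..Suc k. inverse (z ^ j) *\<^sub>R c j)) \<longlongrightarrow> 0 ^ Suc k *\<^sub>R h) (at (0::real))"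
    by (intro tendsto_scaleR tendsto_power tendsto_ident_at Suc.prems)
  moreover have "((\<lambda>z. z ^ Suc k *\<^sub>R (\<Sum>j=1..Suc k. inverse (z ^ j) *\<^sub>R c j)) \<longlongrightarrow> c (Suc k)) (at (0::real))"
  proof (rule Lim_transform_eventually)
    have "((\<lambda>z. (\<Sum>j=1..k. z ^ (Suc k - j) *\<^sub>R c j) + c (Suc k))
        \<longlongrightarrow> (\<Sum>j=1..k. 0 ^ (Suc k - j) *\<^sub>R c j) + c (Suc k)) (at (0::real))"
      by (intro tendsto_intros)
    moreover have "(\<Sum>j=1..k. (0::real) ^ (Suc k - j) *\<^sub>R c j) = 0"
      by (intro sum.neutral) (auto simp: power_0_left)
    ultimately show "((\<lambda>z. (\<Sum>j=1..k. z ^ (Suc k - j) *\<^sub>R c j) + c (Suc k)) \<longlongrightarrow> c (Suc k)) (at (0::real))"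
      by simp
    show "\<forall>\<^sub>F z in at (0::real). (\<Sum>j=1..k. z ^ (Suc k - j) *\<^sub>R c j) + c (Suc k)
       = z ^ Suc k *\<^sub>R (\<Sum>j=1..Suc k. inverse (z ^ j) *\<^sub>R c j)"
      using eventually_at_neq_real
    proof eventually_elim
      case (elim z)
      have "z ^ (Suc k - j) *\<^sub>R c j = z ^ Suc k *\<^sub>R inverse (z ^ j) *\<^sub>R c j" if "j \<in> {1..Suc k}" for j
        using elim that by (simp only: scaleR_scaleR) (simp add: power_diff divide_inverse)
      from this[of "Suc k"] sum.cong[OF refl this, of "{1..k}"] show ?case
        by (simp add: scaleR_sum_right scaleR_add_right del: power_Suc scaleR_scaleR)
    qed
  qed
  ultimately have "c (Suc k) = 0" by (simp add: tendsto_unique[OF trivial_limit_at])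
  with Suc show ?case by (auto simp: le_Suc_eq)
qed

text \<open>The means by which identities between resolvents near the pole become identities between
  Laurent coefficients.\<close>

lemma has_principal_part_unique:
  assumes "has_principal_part k c h f" "has_principal_part k c' h' g" "\<forall>\<^sub>F z in at 0. f z = g z"
  shows "h = h'" and "j \<in> {1..k} \<Longrightarrow> c j = c' j"
proof -
  have "((\<lambda>z. (g z - (\<Sum>j=1..k. inverse (z ^ j) *\<^sub>R c' j)) - (f z - (\<Sum>j=1..k. inverse (z ^ j) *\<^sub>R c j))) \<longlongrightarrow> h' - h) (at 0)"
    using assms(1,2) unfolding has_principal_part_def by (intro tendsto_diff)
  hence "((\<lambda>z. \<Sum>j=1..k. inverse (z ^ j) *\<^sub>R (c j - c' j)) \<longlongrightarrow> h' - h) (at 0)"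
    by (rule Lim_transform_eventually)
       (use assms(3) in \<open>auto elim!: eventually_mono simp: scaleR_diff_right sum_subtractf\<close>)
  from principal_part_zero[OF this] show "h = h'" and "j \<in> {1..k} \<Longrightarrow> c j = c' j" by auto
qed

lemma has_principal_part_diff:
  "has_principal_part k c h f \<Longrightarrow> has_principal_part k c' h' g \<Longrightarrow>
     has_principal_part k (\<lambda>j. c j - c' j) (h - h') (\<lambda>z. f z - g z)"
  unfolding has_principal_part_def
  by (drule (1) tendsto_diff) (simp add: scaleR_diff_right sum_subtractf algebra_simps)

lemma has_principal_part_const: "has_principal_part k (\<lambda>_. 0) h (\<lambda>_. h)"
  by (simp add: has_principal_part_def)

lemma has_principal_part_linear:
  assumes "bounded_linear T" "has_principal_part k c h f"
  shows "has_principal_part k (\<lambda>j. T (c j)) (T h) (\<lambda>z. T (f z))"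
proof -
  interpret bounded_linear T by fact
  from tendsto[OF assms(2)[unfolded has_principal_part_def]] show ?thesis
    by (simp add: has_principal_part_def diff sum scaleR)
qed

text \<open>Multiplication by \<open>z\<close> lowers every order by one and makes
  \<open>c 1\<close> the constant term. The entry \<open>c (Suc k)\<close> moves into position
  \<open>k\<close>; its vanishing keeps it consistent with a principal part of length
  \<open>k\<close>.\<close>

lemma has_principal_part_shift:
  assumes f: "has_principal_part k c h f" and "c (Suc k) = 0"
  shows "has_principal_part k (\<lambda>j. c (Suc j)) (c 1) (\<lambda>z. z *\<^sub>R f z)"
proof -
  have "((\<lambda>z. z *\<^sub>R (f z - (\<Sum>j=1..k. inverse (z ^ j) *\<^sub>R c j)) + c 1) \<longlongrightarrow> 0 *\<^sub>R h + c 1) (at 0)"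
    using f unfolding has_principal_part_def by (intro tendsto_intros)
  hence "((\<lambda>z. z *\<^sub>R (f z - (\<Sum>j=1..k. inverse (z ^ j) *\<^sub>R c j)) + c 1) \<longlongrightarrow> c 1) (at 0)" by simp
  thus ?thesis unfolding has_principal_part_def
  proof (rule Lim_transform_eventually)
    show "\<forall>\<^sub>F z in at 0. z *\<^sub>R (f z - (\<Sum>j=1..k. inverse (z ^ j) *\<^sub>R c j)) + c 1 =
         z *\<^sub>R f z - (\<Sum>j=1..k. inverse (z ^ j) *\<^sub>R c (Suc j))"
      using eventually_at_neq_real
    proof eventually_elim
      case (elim z)
      have "z *\<^sub>R (\<Sum>j=1..k. inverse (z ^ j) *\<^sub>R c j) = z *\<^sub>R (\<Sum>j=1..Suc k. inverse (z ^ j) *\<^sub>R c j)"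
        using assms(2) by simp
      also have "\<dots> = (\<Sum>j=0..k. inverse (z ^ j) *\<^sub>R c (Suc j))"
        using elim unfolding One_nat_def sum.shift_bounds_cl_Suc_ivl scaleR_sum_right
        by (intro sum.cong) simp_all
      also have "\<dots> = c 1 + (\<Sum>j=1..k. inverse (z ^ j) *\<^sub>R c (Suc j))"
        by (simp add: sum.atLeast_Suc_atMost)
      finally show ?case by (simp add: scaleR_diff_right)
    qed
  qed
qed

text \<open>\<open>Q z\<close> models the resolvent at distance \<open>z\<close> from the pole, with
  Laurent coefficients \<open>B j\<close> and constant term \<open>H\<close>. The generator does not
  occur, so the results apply both to the complex resolvents and to their restrictions to real
  vectors.\<close>

locale resolvent_pole =
  fixes Q :: "real \<Rightarrow> 'a::real_normed_vector \<Rightarrow> 'a" and Z :: "real set"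
    and B :: "nat \<Rightarrow> 'a \<Rightarrow> 'a" and H :: "'a \<Rightarrow> 'a" and k :: nat
  assumes Z_ev: "\<forall>\<^sub>F z in at 0. z \<in> Z" and zero_notin_Z: "0 \<notin> Z"
    and Q_bl: "z \<in> Z \<Longrightarrow> bounded_linear (Q z)"
    and B_bl: "bounded_linear (B j)"
    and resolvent_identity: "z \<in> Z \<Longrightarrow> w \<in> Z \<Longrightarrow> Q z f - Q w f = (w - z) *\<^sub>R Q z (Q w f)"
    and k_pos: "1 \<le> k" and B_zero: "k < j \<Longrightarrow> B j f = 0"
    and laurent: "has_principal_part k (\<lambda>j. B j f) (H f) (\<lambda>z. Q z f)"
begin

lemma Q_commute: "z \<in> Z \<Longrightarrow> w \<in> Z \<Longrightarrow> Q z (Q w f) = Q w (Q z f)"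
proof (cases "z = w")
  case False
  assume "z \<in> Z" "w \<in> Z"
  from resolvent_identity[OF this, of f] resolvent_identity[OF this(2,1), of f]
  have "(w - z) *\<^sub>R Q z (Q w f) = (w - z) *\<^sub>R Q w (Q z f)"
    by (metis minus_diff_eq scaleR_minus_left)
  with False show ?thesis by simp
qed simp

text \<open>Both sides are coefficients of the same function
  \<open>T (Q z f) = Q z (T f)\<close>.\<close>

lemma coeff_commute:
  assumes T: "bounded_linear T" and c: "\<And>z f. z \<in> Z \<Longrightarrow> T (Q z f) = Q z (T f)"
  shows "1 \<le> j \<Longrightarrow> T (B j f) = B j (T f)" and "T (H f) = H (T f)"
proof -
  have ev: "\<forall>\<^sub>F z in at 0. T (Q z f) = Q z (T f)" using Z_ev by eventually_elim (rule c)
  note u = has_principal_part_unique[OF has_principal_part_linear[OF T laurent[of f]] laurent[of "T f"] ev]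
  show "T (H f) = H (T f)" by (rule u)
  assume "1 \<le> j"
  thus "T (B j f) = B j (T f)"
    using u(2)[of j] B_zero[of j] bounded_linear.linear[OF T] linear_0[of T] by (cases "j \<le> k") auto
qed

lemma Q_B_commute: "z \<in> Z \<Longrightarrow> 1 \<le> j \<Longrightarrow> Q z (B j f) = B j (Q z f)"
  by (rule coeff_commute(1)[OF Q_bl]) (auto intro: Q_commute)

lemma Q_H_commute: "z \<in> Z \<Longrightarrow> Q z (H f) = H (Q z f)"
  by (rule coeff_commute(2)[OF Q_bl]) (auto intro: Q_commute)

text \<open>Comparison of coefficients in the variable \<open>w\<close> in the identity
  \<open>Q w f - Q z f = (z - w) Q z (Q w f)\<close>, where the factor \<open>w\<close> shifts the
  coefficients.\<close>

lemma coeff_recursion: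
  assumes z: "z \<in> Z"
  shows "1 \<le> j \<Longrightarrow> z *\<^sub>R Q z (B j f) = B j f + Q z (B (Suc j) f)"
    and "z *\<^sub>R Q z (H f) = H f - Q z f + Q z (B 1 f)"
proof -
  interpret Qz: bounded_linear "Q z" by (rule Q_bl[OF z])
  have 1: "has_principal_part k (\<lambda>j. B j f - 0) (H f - Q z f) (\<lambda>w. Q w f - Q z f)"
    by (rule has_principal_part_diff[OF laurent has_principal_part_const])
  have l: "has_principal_part k (\<lambda>j. Q z (B j f)) (Q z (H f)) (\<lambda>w. Q z (Q w f))"
    by (rule has_principal_part_linear[OF Q_bl[OF z] laurent])
  have 2: "has_principal_part k (\<lambda>j. z *\<^sub>R Q z (B j f) - Q z (B (Suc j) f))
      (z *\<^sub>R Q z (H f) - Q z (B 1 f)) (\<lambda>w. z *\<^sub>R Q z (Q w f) - w *\<^sub>R Q z (Q w f))"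
    by (rule has_principal_part_diff[OF has_principal_part_linear[OF bounded_linear_scaleR_right l]
        has_principal_part_shift[OF l]]) (simp add: B_zero Qz.zero)
  have ev: "\<forall>\<^sub>F w in at 0. Q w f - Q z f = z *\<^sub>R Q z (Q w f) - w *\<^sub>R Q z (Q w f)"
    using Z_ev
  proof eventually_elim
    case (elim w)
    have "Q w f - Q z f = (z - w) *\<^sub>R Q w (Q z f)" by (rule resolvent_identity[OF elim z])
    thus ?case using Q_commute[OF elim z, of f] by (simp add: scaleR_diff_left)
  qed
  note u = has_principal_part_unique[OF 1 2 ev]
  show "z *\<^sub>R Q z (H f) = H f - Q z f + Q z (B 1 f)" using u(1) by (simp add: algebra_simps)
  assume j: "1 \<le> j"
  show "z *\<^sub>R Q z (B j f) = B j f + Q z (B (Suc j) f)"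
    using u(2)[of j] j B_zero by (cases "j \<le> k") (auto simp: Qz.zero algebra_simps)
qed

text \<open>The assumption expresses that \<open>x\<close> is an eigenvector at the pole; then
  \<open>Q z x\<close> is its own principal part, with a single term.\<close>

lemma eigenvector_coeffs:
  assumes "\<And>z. z \<in> Z \<Longrightarrow> Q z x = inverse z *\<^sub>R x"
  shows "B 1 x = x" and "2 \<le> j \<Longrightarrow> B j x = 0"
proof -
  have "has_principal_part k (\<lambda>j. if j = 1 then x else 0) 0 (\<lambda>z. inverse z *\<^sub>R x)"
  proof -
    have "(\<Sum>j=1..k. inverse (z ^ j) *\<^sub>R (if j = 1 then x else 0)) = (\<Sum>j=1..k. if j = 1 then inverse z *\<^sub>R x else 0)" for z
      by (rule sum.cong) auto
    moreover have "(\<Sum>j=1..k. if j = 1 then inverse z *\<^sub>R x else 0) = inverse z *\<^sub>R x" for z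
      using k_pos by (subst sum.delta) auto
    ultimately show ?thesis by (simp only: has_principal_part_def diff_self tendsto_const)
  qed
  moreover have "\<forall>\<^sub>F z in at 0. Q z x = inverse z *\<^sub>R x"
    using Z_ev by eventually_elim (rule assms)
  ultimately have u: "B j x = (if j = 1 then x else 0)" if "j \<in> {1..k}" for j
    using that
    by (rule has_principal_part_unique(2)[OF laurent])
  show "B 1 x = x" using u[of 1] k_pos by simp
  show "2 \<le> j \<Longrightarrow> B j x = 0" using u[of j] B_zero[of j x] by (cases "j \<le> k") auto
qed

lemma top_coeff_eigenvector:
  assumes "z \<in> Z" "1 \<le> j" "B (Suc j) f = 0"
  shows "Q z (B j f) = inverse z *\<^sub>R B j f"
proof -
  have "z *\<^sub>R Q z (B j f) = B j f"
    using coeff_recursion(1)[OF assms(1,2), of f] assms linear_0[OF bounded_linear.linear[OF Q_bl[OF assms(1)]]] by simp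
  moreover have "z \<noteq> 0" using assms zero_notin_Z by auto
  ultimately show ?thesis by (metis divideR_right inverse_eq_divide scaleR_one divide_inverse mult_1)
qed

text \<open>Iterating the recursion expands \<open>Q z (B j f)\<close> into a finite principal part
  without a regular term. For \<open>i = j = 1\<close> this says that the residue is a
  projection.\<close>

lemma coeff_mult:
  assumes j: "1 \<le> j"
  shows "1 \<le> i \<Longrightarrow> B i (B j f) = B (j + i - 1) f" and "H (B j f) = 0"
proof -
  have expand: "Q z (B j f) = (\<Sum>i=1..n. inverse (z ^ i) *\<^sub>R B (j + i - 1) f) + inverse (z ^ n) *\<^sub>R Q z (B (j + n) f)"
    if z: "z \<in> Z" for z n
  proof (induction n)
    case (Suc n)
    have "z \<noteq> 0" using z zero_notin_Z by auto
    hence "Q z (B (j + n) f) = inverse z *\<^sub>R (z *\<^sub>R Q z (B (j + n) f))" by simp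
    also have "z *\<^sub>R Q z (B (j + n) f) = B (j + n) f + Q z (B (Suc (j + n)) f)"
      using j by (intro coeff_recursion(1) z) simp
    finally show ?case using Suc by (simp add: scaleR_add_right mult.commute)
  qed simp
  have "has_principal_part k (\<lambda>i. B (j + i - 1) f) 0 (\<lambda>z. Q z (B j f))"
    unfolding has_principal_part_def
  proof (rule Lim_transform_eventually[OF tendsto_const])
    show "\<forall>\<^sub>F z in at 0. 0 = Q z (B j f) - (\<Sum>i=1..k. inverse (z ^ i) *\<^sub>R B (j + i - 1) f)"
      using Z_ev
    proof eventually_elim
      case (elim z)
      \<comment> \<open>After \<open>k\<close> iterations the remainder contains a coefficient of
        index beyond \<open>k\<close>, hence it vanishes.\<close>
      have "Q z (B (j + k) f) = 0"
        using j B_zero[of "j + k" f] linear_0[OF bounded_linear.linear[OF Q_bl[OF elim]]] by simp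
      thus ?case using expand[OF elim, of k] by simp
    qed
  qed
  note u = has_principal_part_unique[OF laurent[of "B j f"] this]
  show "H (B j f) = 0" by (rule u(1)) simp
  assume "1 \<le> i"
  thus "B i (B j f) = B (j + i - 1) f"
    using u(2)[of i] j B_zero[of i] B_zero[of "j + i - 1" f] by (cases "i \<le> k") auto
qed

end

section \<open>Poles of resolvents dominated by a positive vector\<close>

locale dominated_resolvent_pole =
  resolvent_pole Q Z B H k
  for Q :: "real \<Rightarrow> 'r::real_banach_lattice \<Rightarrow> 'r" and Z B H k +
  fixes u x :: 'r
  assumes u_nonneg: "0 \<le> u"
    and dominated: "z \<in> Z \<Longrightarrow> \<exists>M\<ge>0. \<forall>h. labs (Q z h) \<le> (M * norm h) *\<^sub>R u"
    and dense: "closure {f. \<exists>c. labs f \<le> c *\<^sub>R u} = UNIV"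
    and x_nonzero: "x \<noteq> 0" and eigenvector: "z \<in> Z \<Longrightarrow> Q z x = inverse z *\<^sub>R x"
begin

definition sp :: "'r \<Rightarrow> bool" where "sp f \<longleftrightarrow> (\<exists>c>0. c *\<^sub>R u \<le> f)"

lemma labs_eq_0: "labs f = 0 \<Longrightarrow> f = 0"
  using norm_labs[of f] by simp

lemma u_pos: "0 < u"
proof -
  have "u \<noteq> 0"
  proof
    assume "u = 0"
    hence "{f. \<exists>c. labs f \<le> c *\<^sub>R u} \<subseteq> {0}"
      using labs_eq_0 labs_nonneg order_antisym by auto
    hence "closure {f. \<exists>c. labs f \<le> c *\<^sub>R u} \<subseteq> {0}" by (rule closure_minimal) simp
    thus False using dense x_nonzero by auto
  qed
  thus ?thesis using u_nonneg by (simp add: order.strict_iff_order)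
qed

lemma exists_pos: "\<exists>f::'r. 0 < f"
  using u_pos by blast

lemma sp_pos: assumes "sp f" shows "0 < f"
proof -
  obtain c where c: "c > 0" "c *\<^sub>R u \<le> f" using assms by (auto simp: sp_def)
  have "0 \<le> c *\<^sub>R u" using c u_nonneg by (intro scaleR_nonneg_nonneg_bl) auto
  moreover have "c *\<^sub>R u \<noteq> 0" using c u_pos by auto
  ultimately have "0 < c *\<^sub>R u" by (simp add: order.strict_iff_order)
  thus ?thesis using c(2) by (rule less_le_trans)
qed

lemma sp_scaleR: assumes "a > 0" "sp f" shows "sp (a *\<^sub>R f)"
proof -
  obtain c where c: "c > 0" "c *\<^sub>R u \<le> f" using assms by (auto simp: sp_def)
  thus ?thesis using assms(1) bl_scaleR_mono[of a "c *\<^sub>R u" f]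
    by (auto simp: sp_def intro!: exI[of _ "a * c"])
qed

lemma sp_scaleR_iff: "a > 0 \<Longrightarrow> sp (a *\<^sub>R f) \<longleftrightarrow> sp f"
  using sp_scaleR[of a f] sp_scaleR[of "inverse a" "a *\<^sub>R f"] by auto

text \<open>The recursion writes \<open>B 1 f\<close> as a value of \<open>Q z\<close>, to which the
  domination by \<open>u\<close> applies.\<close>

lemma range_coeff_dominated: "\<exists>c>0. labs (B 1 f) \<le> c *\<^sub>R u"
proof -
  obtain z where z: "z \<in> Z" using eventually_happens[OF Z_ev] by auto
  interpret Qz: bounded_linear "Q z" by (rule Q_bl[OF z])
  obtain M where M: "M \<ge> 0" "\<And>h. labs (Q z h) \<le> (M * norm h) *\<^sub>R u" using dominated[OF z] by blast
  have "B 1 f = Q z (z *\<^sub>R B 1 f - B 2 f)"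
    using coeff_recursion(1)[OF z, of 1 f] by (simp add: Qz.diff Qz.scaleR numeral_2_eq_2)
  hence "labs (B 1 f) \<le> (M * norm (z *\<^sub>R B 1 f - B 2 f)) *\<^sub>R u" using M(2) by metis
  also have "\<dots> \<le> (M * norm (z *\<^sub>R B 1 f - B 2 f) + 1) *\<^sub>R u"
    by (intro bl_scaleR_mono_left u_nonneg) simp
  finally show ?thesis using M(1) by (intro exI[of _ "M * norm (z *\<^sub>R B 1 f - B 2 f) + 1"]) (auto simp: add_nonneg_pos)
qed

text \<open>If \<open>v\<close> and \<open>w\<close> lie in the range of \<open>B 1\<close> and \<open>s\<close> is the largest number with
  \<open>s w \<le> v\<close>, then \<open>v - s w\<close> is a positive fixed vector of \<open>B 1\<close> that is not strongly positive.\<close>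

lemma range_residue_one_dim:
  assumes pos: "\<And>f. 0 < f \<Longrightarrow> sp (B 1 f)" and p: "0 < p"
  shows "\<exists>s. B 1 f = s *\<^sub>R B 1 p"
proof -
  interpret B1: bounded_linear "B 1" by (rule B_bl)
  define v w where "v = B 1 f" and "w = B 1 p"
  have idem: "B 1 v = v" "B 1 w = w" unfolding v_def w_def using coeff_mult(1)[of 1 1] by simp_all
  have w: "0 < w" unfolding w_def by (intro sp_pos pos p)
  obtain a where a: "a > 0" "a *\<^sub>R u \<le> w" using pos[OF p] by (auto simp: sp_def w_def)
  obtain b where b: "b > 0" "labs v \<le> b *\<^sub>R u" unfolding v_def using range_coeff_dominated by blast
  obtain d where d: "d > 0" "labs w \<le> d *\<^sub>R u" unfolding w_def using range_coeff_dominated by blast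
  have uw: "b *\<^sub>R u \<le> (b / a) *\<^sub>R w" using bl_scaleR_mono[OF _ a(2), of "b / a"] a b by simp
  have v: "- ((b / a) *\<^sub>R w) \<le> v" "v \<le> (b / a) *\<^sub>R w"
    using order_trans[of "- ((b / a) *\<^sub>R w)" "- (b *\<^sub>R u)" v] order_trans[of v "b *\<^sub>R u" "(b / a) *\<^sub>R w"] b(2) uw
    by (simp_all add: labs_le_iff)
  define C where "C = {c. c *\<^sub>R w \<le> v}"
  have ne: "C \<noteq> {}" using v(1) by (auto simp: C_def intro!: exI[of _ "- (b / a)"])
  have "c \<le> b / a" if "c \<in> C" for c
  proof (rule ccontr)
    assume "\<not> ?thesis"
    hence "c - b / a > 0" by simp
    moreover have "c *\<^sub>R w \<le> (b / a) *\<^sub>R w" using that v(2) by (auto simp: C_def)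
    hence "(c - b / a) *\<^sub>R w \<le> (c - b / a) *\<^sub>R 0" by (simp add: scaleR_diff_left)
    ultimately have "w \<le> 0" using bl_scaleR_le_iff by blast
    thus False using w by simp
  qed
  hence bdd: "bdd_above C" by (rule bdd_aboveI)
  define s where "s = Sup C"
  \<comment> \<open>Some element of \<open>C\<close> lies within \<open>1 / n\<close> of the
    supremum; the Archimedean property then shows that the supremum is attained.\<close>
  have "real n *\<^sub>R (s *\<^sub>R w - v) \<le> w" for n
  proof (cases "n = 0")
    case False
    hence "s - 1 / real n < s" by simp
    then obtain c where c: "c \<in> C" "s - 1 / real n < c"
      unfolding s_def using less_cSup_iff[OF ne bdd] by blast
    hence "(s - 1 / real n) *\<^sub>R w \<le> c *\<^sub>R w" using w by (intro bl_scaleR_mono_left) auto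
    also have "\<dots> \<le> v" using c by (simp add: C_def)
    finally have "s *\<^sub>R w - v \<le> (1 / real n) *\<^sub>R w" by (simp add: scaleR_diff_left diff_le_eq add.commute)
    from bl_scaleR_mono[OF _ this, of "real n"] False show ?thesis by simp
  qed (use w in simp)
  hence sv: "0 \<le> v - s *\<^sub>R w" using bl_archimedean[of "s *\<^sub>R w - v" w] by simp
  have "v - s *\<^sub>R w = 0"
  proof (rule ccontr)
    assume "v - s *\<^sub>R w \<noteq> 0"
    with sv have "0 < v - s *\<^sub>R w" by (simp add: order.strict_iff_order)
    moreover have "B 1 (v - s *\<^sub>R w) = v - s *\<^sub>R w" by (simp only: B1.diff B1.scaleR idem)
    ultimately obtain e where e: "e > 0" "e *\<^sub>R u \<le> v - s *\<^sub>R w" using pos by (metis sp_def)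
    \<comment> \<open>Since \<open>w \<le> d u\<close>, the slack \<open>e u\<close> leaves room for
      another \<open>(e / d) w\<close>, so \<open>s + e / d\<close> would lie in
      \<open>C\<close>.\<close>
    have "(e / d) *\<^sub>R w \<le> (e / d) *\<^sub>R (d *\<^sub>R u)"
      using d e by (intro bl_scaleR_mono) (auto simp: labs_le_iff)
    also have "\<dots> \<le> v - s *\<^sub>R w" using d e by simp
    finally have "(s + e / d) *\<^sub>R w \<le> v" by (simp add: scaleR_add_left le_diff_eq add.commute)
    hence "s + e / d \<le> s" unfolding s_def by (intro cSup_upper bdd) (simp add: C_def s_def)
    thus False using d e by (simp add: divide_le_0_iff)
  qed
  thus ?thesis by (auto simp: v_def w_def)
qed

text \<open>The eigenvector \<open>x\<close> is fixed by \<open>B 1\<close>, so it spans the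
  one-dimensional range of \<open>B 1\<close>. Higher coefficients vanish at \<open>x\<close>, hence
  on that range, and \<open>B j f = B j (B 1 f)\<close>.\<close>

lemma simple_pole:
  assumes pos: "\<And>f. 0 < f \<Longrightarrow> sp (B 1 f)" and j: "2 \<le> j"
  shows "B j f = 0"
proof -
  interpret Bj: bounded_linear "B j" by (rule B_bl)
  obtain p :: 'r where p: "0 < p" using exists_pos by blast
  obtain s where s: "x = s *\<^sub>R B 1 p"
    using range_residue_one_dim[OF pos p, of x] eigenvector_coeffs(1)[OF eigenvector] by auto
  have "B j x = 0" by (rule eigenvector_coeffs(2)[OF eigenvector j])
  hence "s *\<^sub>R B j (B 1 p) = 0" by (simp only: s Bj.scaleR)
  hence 0: "B j (B 1 p) = 0" using s x_nonzero by auto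
  obtain t where "B 1 f = t *\<^sub>R B 1 p" using range_residue_one_dim[OF pos p] by blast
  hence "B j (B 1 f) = 0" using 0 by (simp add: Bj.scaleR)
  thus ?thesis using coeff_mult(1)[of 1 j f] j by simp
qed

text \<open>Domination turns the norm error \<open>g n - y\<close> into an error of at most
  \<open>(c / 2) u\<close> after \<open>Q z\<close> is applied, which leaves half of the lower bound
  \<open>c u\<close>.\<close>

lemma eventually_sp:
  assumes z: "z \<in> Z" and lim: "(g \<longlongrightarrow> y) F" and "sp (Q z y)"
  shows "\<forall>\<^sub>F n in F. sp (Q z (g n))"
proof -
  interpret Qz: bounded_linear "Q z" by (rule Q_bl[OF z])
  obtain c where c: "c > 0" "c *\<^sub>R u \<le> Q z y" using assms(3) by (auto simp: sp_def)
  obtain M where M: "M \<ge> 0" "\<And>h. labs (Q z h) \<le> (M * norm h) *\<^sub>R u" using dominated[OF z] by blast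
  have "((\<lambda>n. M * norm (g n - y)) \<longlongrightarrow> M * norm (y - y)) F" by (intro tendsto_intros lim)
  hence "\<forall>\<^sub>F n in F. M * norm (g n - y) < c / 2" by (rule order_tendstoD) (use c in simp)
  thus ?thesis
  proof eventually_elim
    case (elim n)
    have "- ((c / 2) *\<^sub>R u) \<le> Q z (g n - y)"
    proof -
      have "labs (Q z (g n - y)) \<le> (c / 2) *\<^sub>R u"
        using M(2)[of "g n - y"] bl_scaleR_mono_left[of "M * norm (g n - y)" "c / 2" u] elim u_nonneg
        by (meson less_imp_le order_trans)
      thus ?thesis by (simp add: labs_le_iff)
    qed
    from add_mono[OF c(2) this] have "c *\<^sub>R u - (c / 2) *\<^sub>R u \<le> Q z (g n)" by (simp add: Qz.diff)
    moreover have "c *\<^sub>R u - (c / 2) *\<^sub>R u = (c / 2) *\<^sub>R u" by (simp flip: scaleR_diff_left)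
    ultimately show ?case using c unfolding sp_def by (intro exI[of _ "c / 2"]) auto
  qed
qed

text \<open>With a fixed \<open>m\<close>, the resolvent identity writes \<open>z Q z f\<close> as
  \<open>Q m\<close> applied to a vector that converges in norm, so \<open>eventually_sp\<close>
  applies with limit value \<open>B 1 f\<close>.\<close>

lemma scaled_resolvent_sp:
  assumes simple: "\<And>j f. 2 \<le> j \<Longrightarrow> B j f = 0" and f: "sp (B 1 f)"
  shows "\<forall>\<^sub>F z in at 0. sp (z *\<^sub>R Q z f)"
proof -
  obtain m where m: "m \<in> Z" using eventually_happens[OF Z_ev] by auto
  interpret Qm: bounded_linear "Q m" by (rule Q_bl[OF m])
  have "has_principal_part k (\<lambda>j. B (Suc j) f) (B 1 f) (\<lambda>z. z *\<^sub>R Q z f)"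
    by (intro has_principal_part_shift[OF laurent] B_zero) simp
  hence "((\<lambda>z. z *\<^sub>R Q z f) \<longlongrightarrow> B 1 f) (at 0)" by (simp add: has_principal_part_def simple)
  hence "((\<lambda>z. z *\<^sub>R f + (m - z) *\<^sub>R z *\<^sub>R Q z f) \<longlongrightarrow> 0 *\<^sub>R f + (m - 0) *\<^sub>R B 1 f) (at 0)"
    by (intro tendsto_intros)
  moreover have "Q m (0 *\<^sub>R f + (m - 0) *\<^sub>R B 1 f) = B 1 f"
    using coeff_recursion(1)[OF m, of 1 f] simple[of 2 f] by (simp add: Qm.scaleR numeral_2_eq_2)
  ultimately have "\<forall>\<^sub>F z in at 0. sp (Q m (z *\<^sub>R f + (m - z) *\<^sub>R z *\<^sub>R Q z f))"
    using f by (intro eventually_sp[OF m]) auto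
  thus ?thesis using Z_ev
  proof eventually_elim
    case (elim z)
    have "Q z f = Q m f + (m - z) *\<^sub>R Q m (Q z f)"
      using resolvent_identity[OF elim(2) m, of f] Q_commute[OF m elim(2), of f] by (simp add: algebra_simps)
    hence "z *\<^sub>R Q z f = Q m (z *\<^sub>R f + (m - z) *\<^sub>R z *\<^sub>R Q z f)"
      by (metis Qm.add Qm.scaleR scaleR_add_right scaleR_left_commute)
    with elim(1) show ?case by simp
  qed
qed

section \<open>From positivity of resolvents or their powers to the residue\<close>

lemma top_coeff_exists: "\<exists>K\<ge>1. (\<exists>f. B K f \<noteq> 0) \<and> (\<forall>j>K. \<forall>f. B j f = 0)"
proof -
  define J where "J = {j. 1 \<le> j \<and> (\<exists>f. B j f \<noteq> 0)}"
  have fin: "finite J" by (rule finite_subset[of _ "{..k}"]) (use B_zero not_le in \<open>auto simp: J_def\<close>)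
  have "1 \<in> J" using eigenvector_coeffs(1)[OF eigenvector] x_nonzero by (auto simp: J_def intro!: exI[of _ x])
  hence "Max J \<in> J" using fin by (intro Max_in) auto
  moreover have "B j f = 0" if "Max J < j" for j f
  proof (rule ccontr)
    assume "B j f \<noteq> 0"
    hence "j \<in> J" using that \<open>Max J \<in> J\<close> by (auto simp: J_def)
    hence "j \<le> Max J" using fin by simp
    thus False using that by simp
  qed
  ultimately show ?thesis unfolding J_def by blast
qed

text \<open>Multiplying by \<open>z\<close> altogether \<open>K\<close> times shifts
  \<open>B K f\<close> into the constant term, and the remaining principal part consists of
  zeros.\<close>

lemma top_coeff_limit:
  assumes K: "1 \<le> K" "\<And>j. j > K \<Longrightarrow> B j f = 0"
  shows "((\<lambda>z. z ^ K *\<^sub>R Q z f) \<longlongrightarrow> B K f) (at 0)"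
proof -
  have "has_principal_part k (\<lambda>j. B (j + Suc n) f) (B (Suc n) f) (\<lambda>z. z ^ Suc n *\<^sub>R Q z f)" for n
  proof (induction n)
    case 0
    show ?case using has_principal_part_shift[OF laurent] by (simp add: B_zero)
  next
    case (Suc n)
    from has_principal_part_shift[OF Suc] show ?case by (simp add: B_zero)
  qed
  from this[of "K - 1"] K show ?thesis by (simp add: has_principal_part_def)
qed

text \<open>Common core of the implications towards the residue. The scalar \<open>c\<close> makes
  the coefficient of lowest order positive; the vectors \<open>g\<close> show that it kills no
  positive vector; the last assumption on \<open>y\<close> upgrades positive eigenvectors to
  strongly positive ones.\<close>

lemma residue_sp:
  assumes K: "1 \<le> K" "\<exists>f. B K f \<noteq> 0" "\<And>j f. j > K \<Longrightarrow> B j f = 0"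
    and c: "c \<noteq> 0" and pos: "\<And>f. 0 < f \<Longrightarrow> 0 \<le> c *\<^sub>R B K f"
    and g: "\<And>f. 0 < f \<Longrightarrow> \<exists>g. sp g \<and> (B K f = 0 \<longrightarrow> B K g = 0)"
    and e: "\<And>y. 0 < y \<Longrightarrow> (\<And>z. z \<in> Z \<Longrightarrow> Q z y = inverse z *\<^sub>R y) \<Longrightarrow> sp y"
    and f: "0 < f"
  shows "sp (B 1 f)"
proof -
  interpret BK: bounded_linear "B K" by (rule B_bl)
  have pos': "0 \<le> c *\<^sub>R B K f" if "0 \<le> f" for f
    using that pos[of f] by (cases "f = 0") (auto simp: BK.zero order.strict_iff_order)
  have mono: "c *\<^sub>R B K f \<le> c *\<^sub>R B K h" if "f \<le> h" for f h
    using pos'[of "h - f"] that by (simp add: BK.diff scaleR_diff_right)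
  \<comment> \<open>If \<open>B K\<close> killed a positive vector, it would kill a strongly
    positive one, hence \<open>u\<close> by monotonicity, hence the ideal of \<open>u\<close>, and
    by density everything.\<close>
  have nz: "B K f \<noteq> 0" if f: "0 < f" for f
  proof
    assume 0: "B K f = 0"
    obtain g where g: "sp g" "B K g = 0" using g[OF f] 0 by blast
    then obtain a where a: "a > 0" "a *\<^sub>R u \<le> g" by (auto simp: sp_def)
    have "c *\<^sub>R B K (a *\<^sub>R u) \<le> 0" using mono[OF a(2)] g by simp
    moreover have "0 \<le> c *\<^sub>R B K (a *\<^sub>R u)"
      using a u_nonneg by (intro pos' scaleR_nonneg_nonneg_bl) auto
    ultimately have "c *\<^sub>R B K (a *\<^sub>R u) = 0" by (rule order_antisym)
    hence u0: "B K u = 0" using c a by (simp add: BK.scaleR)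
    have "{f. \<exists>c. labs f \<le> c *\<^sub>R u} \<subseteq> {h. B K h = 0}"
    proof safe
      fix h b assume h: "labs h \<le> b *\<^sub>R u"
      hence "c *\<^sub>R B K h \<le> c *\<^sub>R B K (b *\<^sub>R u)" "c *\<^sub>R B K (- (b *\<^sub>R u)) \<le> c *\<^sub>R B K h"
        by (auto intro!: mono simp: labs_le_iff)
      hence "c *\<^sub>R B K h = 0" using u0 by (simp add: BK.scaleR BK.neg order_antisym)
      thus "B K h = 0" using c by simp
    qed
    moreover have "closed {h. B K h = 0}"
      by (intro closed_Collect_eq continuous_intros linear_continuous_on BK.bounded_linear_axioms)
    ultimately have "closure {f. \<exists>c. labs f \<le> c *\<^sub>R u} \<subseteq> {h. B K h = 0}" by (rule closure_minimal)
    thus False using dense K(2) by auto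
  qed
  define w where "w f = c *\<^sub>R B K f" for f
  have eigw: "Q z (w f) = inverse z *\<^sub>R w f" if "z \<in> Z" for z f
    using top_coeff_eigenvector[OF that K(1), of f] K(3) linear_scale[OF bounded_linear.linear[OF Q_bl[OF that]]]
    by (simp add: w_def)
  have w: "0 < w f" if "0 < f" for f
    using pos[OF that] nz[OF that] c by (simp add: w_def order.strict_iff_order)
  have spw: "sp (w f)" if "0 < f" for f using e[OF w[OF that] eigw] .
  \<comment> \<open>For \<open>K \<ge> 2\<close> the operator \<open>B K\<close> vanishes on the
    eigenvector \<open>w f\<close>, which is a positive vector.\<close>
  have K1: "K = 1"
  proof (rule ccontr)
    assume "K \<noteq> 1"
    hence "2 \<le> K" using K(1) by simp
    have "B K (w f) = 0" by (rule eigenvector_coeffs(2)[OF eigw \<open>2 \<le> K\<close>])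
    thus False using nz[OF w[OF f]] by simp
  qed
  have "w (w f) = c *\<^sub>R w f" unfolding w_def[of "w f"] K1 by (simp only: eigenvector_coeffs(1)[OF eigw])
  hence "0 < c *\<^sub>R w f" using w[OF w[OF f]] by simp
  \<comment> \<open>Since \<open>B 1\<close> fixes the positive eigenvector \<open>w f\<close>, a
    negative \<open>c\<close> would make \<open>c w f\<close> both positive and negative.\<close>
  have "c > 0"
  proof (rule ccontr)
    assume "\<not> c > 0"
    hence "0 \<le> (- c) *\<^sub>R w f" using w[OF f] by (intro scaleR_nonneg_nonneg_bl) auto
    with \<open>0 < c *\<^sub>R w f\<close> show False by simp
  qed
  thus ?thesis using spw[OF f] sp_scaleR_iff[of c "B 1 f"] by (simp add: w_def K1)
qed

text \<open>Treats both sides of the pole at once: \<open>s = 1\<close> with \<open>z\<close>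
  tending to 0 from the right, \<open>s = -1\<close> from the left.\<close>

lemma residue_sp_of_resolvent_sign:
  assumes s: "s = 1 \<or> s = -1" and F: "F \<le> at 0" "F \<noteq> bot" and sgn: "\<forall>\<^sub>F z in F. 0 < s * z"
    and res: "\<And>f. 0 < f \<Longrightarrow> \<forall>\<^sub>F z in F. sp (s *\<^sub>R Q z f)" and f: "0 < f"
  shows "sp (B 1 f)"
proof -
  obtain K where K: "1 \<le> K" "\<exists>f. B K f \<noteq> 0" "\<And>j f. j > K \<Longrightarrow> B j f = 0"
    using top_coeff_exists by blast
  interpret BK: bounded_linear "B K" by (rule B_bl)
  have ZF: "\<forall>\<^sub>F z in F. z \<in> Z" using F(1) Z_ev by (rule filter_leD)
  \<comment> \<open>The exponent collects one sign \<open>s\<close> from each of the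
    \<open>K\<close> factors \<open>z\<close> and one from the resolvent itself.\<close>
  show ?thesis
  proof (rule residue_sp[OF K, where c = "s ^ Suc K"])
    fix f :: 'r assume f: "0 < f"
    have "((\<lambda>z. z ^ K *\<^sub>R Q z f) \<longlongrightarrow> B K f) F"
      using top_coeff_limit[OF K(1,3)] F(1) by (rule tendsto_mono[rotated])
    hence "((\<lambda>z. s ^ Suc K *\<^sub>R z ^ K *\<^sub>R Q z f) \<longlongrightarrow> s ^ Suc K *\<^sub>R B K f) F"
      by (intro tendsto_intros)
    moreover have "\<forall>\<^sub>F z in F. 0 \<le> s ^ Suc K *\<^sub>R z ^ K *\<^sub>R Q z f"
      using res[OF f] sgn
    proof eventually_elim
      case (elim z)
      have "0 \<le> (s * z) ^ K *\<^sub>R (s *\<^sub>R Q z f)"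
        by (rule scaleR_nonneg_nonneg_bl[OF zero_le_power[OF less_imp_le[OF elim(2)]] less_imp_le[OF sp_pos[OF elim(1)]]])
      thus ?case by (simp add: power_mult_distrib mult_ac)
    qed
    ultimately show "0 \<le> s ^ Suc K *\<^sub>R B K f" using F(2) by (intro tendsto_bl_le)
    obtain z where z: "z \<in> Z" "sp (s *\<^sub>R Q z f)"
      using eventually_happens[OF eventually_conj[OF ZF res[OF f]]] F(2) by auto
    have "B K f = 0 \<longrightarrow> B K (s *\<^sub>R Q z f) = 0"
      using Q_B_commute[OF z(1) K(1), of f] linear_0[OF bounded_linear.linear[OF Q_bl[OF z(1)]]]
      by (auto simp: BK.scaleR)
    with z show "\<exists>g. sp g \<and> (B K f = 0 \<longrightarrow> B K g = 0)" by blast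
  next
    fix y :: 'r assume y: "0 < y" "\<And>z. z \<in> Z \<Longrightarrow> Q z y = inverse z *\<^sub>R y"
    obtain z where z: "z \<in> Z" "0 < s * z" "sp (s *\<^sub>R Q z y)"
      using eventually_happens[OF eventually_conj[OF ZF eventually_conj[OF sgn res[OF y(1)]]]] F(2) by auto
    have "s *\<^sub>R Q z y = (s * inverse z) *\<^sub>R y" using y(2)[OF z(1)] by simp
    moreover have "0 < s * inverse z" using z(2) by (simp add: zero_less_mult_iff)
    ultimately show "sp y" using z(3) sp_scaleR_iff by simp
  qed (use s f in auto)
qed

text \<open>\<open>Q z\<close> is the sum of the Neumann series in powers of \<open>Q m\<close>. All
  but finitely many of its terms at \<open>f\<close> are positive, and the finitely many others stay
  bounded as \<open>z\<close> tends to 0, so they do not affect the limit of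
  \<open>z^K Q z f\<close>.\<close>

lemma residue_sp_of_powers:
  assumes m: "0 < m" "{0<..m} \<subseteq> Z"
    and conv: "\<And>z f. 0 < z \<Longrightarrow> z < m \<Longrightarrow> (\<lambda>n. (m - z) ^ n *\<^sub>R (Q m ^^ n) f) \<longlonglongrightarrow> 0"
    and pow: "\<And>f. 0 < f \<Longrightarrow> \<exists>n0. \<forall>n\<ge>n0. sp ((Q m ^^ n) f)" and f: "0 < f"
  shows "sp (B 1 f)"
proof -
  obtain K where K: "1 \<le> K" "\<exists>f. B K f \<noteq> 0" "\<And>j f. j > K \<Longrightarrow> B j f = 0"
    using top_coeff_exists by blast
  interpret BK: bounded_linear "B K" by (rule B_bl)
  have mZ: "m \<in> Z" using m by auto
  interpret Qm: bounded_linear "Q m" by (rule Q_bl[OF mZ])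
  have expand: "Q z f = (\<Sum>i<n. (m - z) ^ i *\<^sub>R (Q m ^^ Suc i) f) + (m - z) ^ n *\<^sub>R (Q m ^^ n) (Q z f)"
    if z: "z \<in> Z" for z n f
  proof (induction n)
    case (Suc n)
    interpret Qmn: bounded_linear "Q m ^^ n" by (rule bounded_linear_funpow) (rule Q_bl[OF mZ])
    have "Q z f = Q m f + (m - z) *\<^sub>R Q m (Q z f)"
      using resolvent_identity[OF z mZ, of f] Q_commute[OF mZ z, of f] by (simp add: algebra_simps)
    hence "(Q m ^^ n) (Q z f) = (Q m ^^ Suc n) f + (m - z) *\<^sub>R (Q m ^^ Suc n) (Q z f)"
      by (metis Qmn.add Qmn.scaleR funpow_Suc_right o_apply)
    hence "(m - z) ^ n *\<^sub>R (Q m ^^ n) (Q z f)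
        = (m - z) ^ n *\<^sub>R (Q m ^^ Suc n) f + (m - z) ^ Suc n *\<^sub>R (Q m ^^ Suc n) (Q z f)"
      by (drule_tac arg_cong[where f = "scaleR ((m - z) ^ n)"]) (simp only: scaleR_add_right scaleR_scaleR power_Suc2)
    with Suc.IH show ?case by (simp only: sum.lessThan_Suc add.assoc)
  qed simp
  show ?thesis
  proof (rule residue_sp[OF K, where c = 1])
    fix f :: 'r assume f: "0 < f"
    obtain n0 where n0: "\<And>n. n \<ge> n0 \<Longrightarrow> sp ((Q m ^^ n) f)" using pow[OF f] by blast
    \<comment> \<open>The initial terms of unknown sign; being polynomial in \<open>z\<close>, they
      disappear after multiplication by \<open>z ^ K\<close>.\<close>
    define p where "p z = (\<Sum>i<n0. (m - z) ^ i *\<^sub>R (Q m ^^ Suc i) f)" for z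
    have low: "p z \<le> Q z f" if z: "0 < z" "z < m" for z
    proof -
      have zZ: "z \<in> Z" using z m by auto
      have "(\<lambda>n. Q z f - (m - z) ^ n *\<^sub>R (Q m ^^ n) (Q z f)) \<longlonglongrightarrow> Q z f - 0"
        by (intro tendsto_diff tendsto_const conv z)
      moreover have "\<forall>\<^sub>F n in sequentially. p z \<le> Q z f - (m - z) ^ n *\<^sub>R (Q m ^^ n) (Q z f)"
        using eventually_ge_at_top[of n0]
      proof eventually_elim
        case (elim n)
        have "0 \<le> (Q m ^^ Suc i) f" if "i \<in> {n0..<n}" for i
          using that by (intro less_imp_le sp_pos n0) simp
        hence "0 \<le> (\<Sum>i=n0..<n. (m - z) ^ i *\<^sub>R (Q m ^^ Suc i) f)"
          using z by (intro sum_nonneg scaleR_nonneg_nonneg_bl) auto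
        moreover have "(\<Sum>i<n. (m - z) ^ i *\<^sub>R (Q m ^^ Suc i) f)
            = p z + (\<Sum>i=n0..<n. (m - z) ^ i *\<^sub>R (Q m ^^ Suc i) f)"
          unfolding p_def lessThan_atLeast0 using elim by (subst sum.atLeastLessThan_concat) auto
        moreover have "Q z f - (m - z) ^ n *\<^sub>R (Q m ^^ n) (Q z f) = (\<Sum>i<n. (m - z) ^ i *\<^sub>R (Q m ^^ Suc i) f)"
          using expand[OF zZ, of f n] by (simp only: diff_eq_eq)
        ultimately show ?case by (simp only: le_add_same_cancel1)
      qed
      ultimately show ?thesis by (intro tendsto_bl_le) auto
    qed
    have "((\<lambda>z. z ^ K *\<^sub>R Q z f - z ^ K *\<^sub>R p z) \<longlongrightarrow> B K f - 0 ^ K *\<^sub>R p 0) (at_right 0)"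
    proof (intro tendsto_diff tendsto_scaleR tendsto_power tendsto_ident_at)
      show "((\<lambda>z. z ^ K *\<^sub>R Q z f) \<longlongrightarrow> B K f) (at_right 0)"
        using top_coeff_limit[OF K(1,3)] at_le[of "{0<..}" UNIV "0::real"] by (auto intro: tendsto_mono[rotated])
      show "(p \<longlongrightarrow> p 0) (at_right 0)" unfolding p_def by (intro tendsto_intros)
    qed
    moreover have "\<forall>\<^sub>F z in at_right 0. 0 \<le> z ^ K *\<^sub>R Q z f - z ^ K *\<^sub>R p z"
      using eventually_at_right_real[OF m(1)]
    proof eventually_elim
      case (elim z)
      thus ?case using bl_scaleR_mono[OF _ low, of "z ^ K" z] by simp
    qed
    ultimately have "0 \<le> B K f - 0 ^ K *\<^sub>R p 0" by (intro tendsto_bl_le) auto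
    thus "0 \<le> 1 *\<^sub>R B K f" using K(1) by (simp add: power_0_left)
    \<comment> \<open>Commutation makes a sufficiently high power of \<open>Q m\<close> at
      \<open>f\<close> the strongly positive vector \<open>g\<close> that \<open>residue_sp\<close>
      asks for.\<close>
    have "(Q m ^^ n) (B K f) = B K ((Q m ^^ n) f)" for n
      by (induction n) (simp_all add: Q_B_commute[OF mZ K(1)])
    moreover have "(Q m ^^ n) 0 = 0" for n by (induction n) (simp_all add: Qm.zero)
    ultimately have "B K f = 0 \<longrightarrow> B K ((Q m ^^ n0) f) = 0" by metis
    thus "\<exists>g. sp g \<and> (B K f = 0 \<longrightarrow> B K g = 0)" using n0[of n0] by blast
  next
    fix y :: 'r assume y: "0 < y" "\<And>z. z \<in> Z \<Longrightarrow> Q z y = inverse z *\<^sub>R y"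
    obtain n where n: "sp ((Q m ^^ n) y)" using pow[OF y(1)] by blast
    have "(Q m ^^ n) y = inverse m ^ n *\<^sub>R y" for n
      by (induction n) (simp_all add: Qm.scaleR y(2)[OF mZ] mult.commute)
    with n m(1) show "sp y" using sp_scaleR_iff by simp
  qed (use f in auto)
qed

text \<open>One of the \<open>n + 1\<close> factors \<open>Q m\<close> is set aside to convert norm
  convergence of the other \<open>n\<close> into strong positivity.\<close>

lemma powers_sp:
  assumes simple: "\<And>j f. 2 \<le> j \<Longrightarrow> B j f = 0" and f: "sp (B 1 f)" and m: "0 < m" "m \<in> Z"
    and conv: "(\<lambda>n. m ^ n *\<^sub>R (Q m ^^ n) f) \<longlonglongrightarrow> B 1 f"
  shows "\<exists>n0. \<forall>n\<ge>n0. sp ((Q m ^^ n) f)"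
proof -
  interpret Qm: bounded_linear "Q m" by (rule Q_bl[OF m(2)])
  have "Q m (m *\<^sub>R B 1 f) = B 1 f"
    using coeff_recursion(1)[OF m(2), of 1 f] simple[of 2 f] by (simp add: Qm.scaleR numeral_2_eq_2 Qm.zero)
  hence "\<forall>\<^sub>F n in sequentially. sp (Q m (m *\<^sub>R m ^ n *\<^sub>R (Q m ^^ n) f))"
    using f by (intro eventually_sp[OF m(2) tendsto_scaleR[OF tendsto_const conv]]) simp
  hence "\<forall>\<^sub>F n in sequentially. sp ((Q m ^^ Suc n) f)"
  proof eventually_elim
    case (elim n)
    have "Q m (m *\<^sub>R m ^ n *\<^sub>R (Q m ^^ n) f) = m ^ Suc n *\<^sub>R (Q m ^^ Suc n) f" by (simp add: Qm.scaleR)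
    with elim show ?case using m(1) sp_scaleR_iff[of "m ^ Suc n"] by (simp del: power_Suc)
  qed
  hence "\<forall>\<^sub>F n in sequentially. sp ((Q m ^^ n) f)" by (subst (asm) eventually_sequentially_Suc)
  thus ?thesis by (simp add: eventually_sequentially)
qed

end

section \<open>Resolvents of complex operators\<close>

lemma cscale_cancel: assumes "c \<noteq> 0" "cscale c f = cscale c g" shows "f = g"
  using arg_cong[OF assms(2), of "cscale (inverse c)"] assms(1) by (simp flip: cscale_mult)

locale complex_operator =
  fixes A :: "'r::real_banach_lattice \<times> 'r \<Rightarrow> 'r \<times> 'r" and D :: "('r \<times> 'r) set"
  assumes lin: "clinear_op A D"
begin

abbreviation R :: "complex \<Rightarrow> 'r \<times> 'r \<Rightarrow> 'r \<times> 'r" where "R \<equiv> op_resolvent A D"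

abbreviation \<rho> :: "complex set" where "\<rho> \<equiv> resolvent_set A D"

lemma A_add: "f \<in> D \<Longrightarrow> g \<in> D \<Longrightarrow> A (f + g) = A f + A g"
  and A_cscale: "f \<in> D \<Longrightarrow> A (cscale c f) = cscale c (A f)"
  and D_cscale: "f \<in> D \<Longrightarrow> cscale c f \<in> D"
  using lin by (auto simp: clinear_op_def)

lemma resolvent_eqI:
  assumes l: "l \<in> \<rho>" and g: "g \<in> D" "cscale l g - A g = f"
  shows "R l f = g"
proof -
  have "inj_on (\<lambda>g. cscale l g - A g) D" using l by (simp add: resolvent_set_def bij_betw_def)
  thus ?thesis unfolding op_resolvent_def using g by (intro the_equality) (auto dest: inj_onD)
qed

lemma
  assumes l: "l \<in> \<rho>"
  shows resolvent_in_D: "R l f \<in> D" and resolvent_eq: "cscale l (R l f) - A (R l f) = f"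
proof -
  have "f \<in> (\<lambda>g. cscale l g - A g) ` D" using l by (simp add: resolvent_set_def bij_betw_def)
  then obtain g where g: "g \<in> D" "cscale l g - A g = f" by auto
  with resolvent_eqI[OF l g] show "R l f \<in> D" "cscale l (R l f) - A (R l f) = f" by simp_all
qed

lemma resolvent_bounded: "l \<in> \<rho> \<Longrightarrow> bounded_clinear_op (R l)"
  by (simp add: resolvent_set_def)

lemma resolvent_linear: "l \<in> \<rho> \<Longrightarrow> bounded_linear (R l)"
  by (intro bounded_clinear_op_imp_bounded_linear resolvent_bounded)

lemma resolvent_cscale: "l \<in> \<rho> \<Longrightarrow> R l (cscale c f) = cscale c (R l f)"
  by (intro bounded_clinear_op_cscale resolvent_bounded)

lemma resolvent_difference:
  assumes l: "l \<in> \<rho>" and m: "m \<in> \<rho>"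
  shows "R l f - R m f = cscale (m - l) (R l (R m f))"
proof -
  interpret Rl: bounded_linear "R l" by (rule resolvent_linear[OF l])
  have "cscale l (R m f) - A (R m f) = f - cscale (m - l) (R m f)"
    using resolvent_eq[OF m, of f] by (simp add: cscale_diff_left algebra_simps)
  hence "R m f = R l (f - cscale (m - l) (R m f))"
    using resolvent_eqI[OF l resolvent_in_D[OF m]] by metis
  hence "R m f = R l f - cscale (m - l) (R l (R m f))" by (simp only: Rl.diff resolvent_cscale[OF l])
  thus ?thesis by (simp only: eq_diff_eq diff_eq_eq add.commute)
qed

lemma resolvent_commute:
  assumes l: "l \<in> \<rho>" and m: "m \<in> \<rho>"
  shows "R l (R m f) = R m (R l f)"
proof (cases "l = m")
  case False
  have "cscale (m - l) (R l (R m f)) = - cscale (l - m) (R m (R l f))"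
    using resolvent_difference[OF l m, of f] resolvent_difference[OF m l, of f] by (metis minus_diff_eq)
  also have "\<dots> = cscale (m - l) (R m (R l f))" by (simp add: cscale_diff_left)
  finally show ?thesis by (rule cscale_cancel[rotated]) (use False in simp)
qed simp

lemma resolvent_eigenvector:
  assumes "x \<in> D" "A x = cscale a x" "l \<in> \<rho>" "l \<noteq> a"
  shows "R l x = cscale (inverse (l - a)) x"
proof -
  have "R l (cscale (l - a) x) = x"
    using assms by (intro resolvent_eqI) (simp_all add: cscale_diff_left)
  hence "cscale (l - a) (R l x) = cscale (l - a) (cscale (inverse (l - a)) x)"
    using assms by (simp add: resolvent_cscale flip: cscale_mult)
  thus ?thesis by (rule cscale_cancel[rotated]) (use assms in simp)
qed

text \<open>The inverse of \<open>1 - w d R(m)\<close> is \<open>1 + w d R(m - w d)\<close> because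
  \<open>(m - w d) - A = (1 - w d R(m)) (m - A)\<close>.\<close>

lemma power_bounded_resolvent_scaled:
  assumes m: "m \<in> \<rho>" and r: "\<And>w. cmod w \<le> 1 \<Longrightarrow> m - w * d \<in> \<rho>"
  shows "power_bounded_resolvent (\<lambda>f. cscale d (R m f)) (\<lambda>w g. g + cscale (w * d) (R (m - w * d) g))"
proof (rule power_bounded_resolvent.intro)
  interpret Rm: bounded_linear "R m" by (rule resolvent_linear[OF m])
  have c: "clinear_op (\<lambda>f. cscale d (R m f)) UNIV"
    unfolding clinear_op_def by (simp add: Rm.add cscale_add_right resolvent_cscale[OF m] mult.commute flip: cscale_mult)
  have "bounded_linear (\<lambda>f. cscale d (R m f))"
    by (rule bounded_linear_compose[OF bounded_linear_cscale resolvent_linear[OF m]])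
  then obtain K where "\<And>f. norm (cscale d (R m f)) \<le> norm f * K" using bounded_linear.bounded by blast
  thus "bounded_clinear_op (\<lambda>f. cscale d (R m f))"
    unfolding bounded_clinear_op_def using c by (auto simp: mult.commute)
next
  fix w :: complex and g assume w: "cmod w \<le> 1"
  let ?L = "R (m - w * d)" and ?c = "w * d"
  have L: "m - w * d \<in> \<rho>" by (rule r[OF w])
  interpret L: bounded_linear ?L by (rule resolvent_linear[OF L])
  interpret Rm: bounded_linear "R m" by (rule resolvent_linear[OF m])
  show "bounded_linear (\<lambda>g. g + cscale ?c (?L g))"
    by (intro bounded_linear_add bounded_linear_ident bounded_linear_compose[OF bounded_linear_cscale L.bounded_linear_axioms])
  have diff: "?L g - R m g = cscale ?c (?L (R m g))" using resolvent_difference[OF L m, of g] by simp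
  have comm: "R m (?L g) = ?L (R m g)" by (rule resolvent_commute[OF m L])
  have c: "cscale w (cscale d h) = cscale ?c h" for h by (simp add: cscale_mult)
  have key: "cscale ?c (?L g) - cscale ?c (R m g) = cscale ?c (cscale ?c (?L (R m g)))"
    by (simp only: diff flip: cscale_diff_right)
  show "g - cscale w (cscale d (R m g)) + cscale ?c (?L (g - cscale w (cscale d (R m g)))) = g"
    using key by (simp only: c L.diff resolvent_cscale[OF L] cscale_diff_right) (simp add: algebra_simps)
  show "g + cscale ?c (?L g) - cscale w (cscale d (R m (g + cscale ?c (?L g)))) = g"
    using key by (simp only: c Rm.add resolvent_cscale[OF m] cscale_add_right comm) (simp add: algebra_simps)
qed

end

section \<open>Real operators\<close>

locale real_operator = complex_operator A D
  for A :: "'r::real_banach_lattice \<times> 'r \<Rightarrow> 'r \<times> 'r" and D +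
  assumes real: "real_op A D"
begin

lemma split_real:
  assumes "f \<in> D"
  obtains y1 y2 where "f = (y1, y2)" "(y1, 0) \<in> D" "(y2, 0) \<in> D" "snd (A (y1, 0)) = 0" "snd (A (y2, 0)) = 0"
    "A f = (fst (A (y1, 0)), fst (A (y2, 0)))"
proof -
  obtain g h where gh: "f = g + cscale \<i> h" "g \<in> D" "h \<in> D" "snd g = 0" "snd h = 0"
    using subsetD[OF equalityD1[OF conjunct1[OF real[unfolded real_op_def]]] assms]
    by (auto simp: ERe_def)
  have sn: "snd (A e) = 0" if "e \<in> D" "snd e = 0" for e
    using real that by (auto simp: real_op_def ERe_def)
  obtain y1 y2 where y: "g = (y1, 0)" "h = (y2, 0)" using gh by (metis prod.collapse)
  have "A f = A g + cscale \<i> (A h)" using gh by (simp add: A_add A_cscale D_cscale)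
  hence "A f = (fst (A (y1, 0)), fst (A (y2, 0)))"
    using sn[OF gh(2,4)] sn[OF gh(3,5)] by (simp add: y cscale_def) (simp add: prod_eq_iff)
  moreover have "f = (y1, y2)" by (simp add: gh(1) y cscale_def)
  ultimately show ?thesis using gh sn[OF gh(2,4)] sn[OF gh(3,5)] unfolding y by (intro that[of y1 y2])
qed

text \<open>The imaginary part of the resolvent value solves the homogeneous equation, so it is
  zero.\<close>

lemma resolvent_real:
  assumes l: "complex_of_real l \<in> \<rho>" shows "snd (R (complex_of_real l) (y, 0)) = 0"
proof -
  interpret Rl: bounded_linear "R (complex_of_real l)" by (rule resolvent_linear[OF l])
  let ?g = "R (complex_of_real l) (y, 0)"
  obtain y1 y2 where g: "?g = (y1, y2)" "(y2, 0) \<in> D" "snd (A (y2, 0)) = 0" "snd (A ?g) = fst (A (y2, 0))"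
    using split_real[OF resolvent_in_D[OF l, of "(y, 0)"]] by (metis snd_conv)
  have "l *\<^sub>R y2 - fst (A (y2, 0)) = 0"
    using arg_cong[OF resolvent_eq[OF l, of "(y, 0)"], of snd] g by simp
  hence "l *\<^sub>R (y2, 0) - A (y2, 0) = 0" using g(3) by (simp add: prod_eq_iff)
  hence "R (complex_of_real l) 0 = (y2, 0)" using g(2) by (intro resolvent_eqI[OF l]) auto
  hence "y2 = 0" using Rl.zero by (simp add: zero_prod_def)
  thus ?thesis using g(1) by simp
qed

text \<open>Real and imaginary part of an eigenvector both satisfy the eigenvalue equation, and at
  least one of them is nonzero.\<close>

lemma real_eigenvector:
  assumes "is_eigenvalue A D (complex_of_real l)"
  obtains x where "x \<noteq> 0" "(x, 0) \<in> D" "A (x, 0) = l *\<^sub>R (x, 0)"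
proof -
  obtain f where f: "f \<in> D" "f \<noteq> 0" "A f = l *\<^sub>R f" using assms by (auto simp: is_eigenvalue_def)
  obtain y1 y2 where y: "f = (y1, y2)" "(y1, 0) \<in> D" "(y2, 0) \<in> D" "snd (A (y1, 0)) = 0" "snd (A (y2, 0)) = 0"
    "A f = (fst (A (y1, 0)), fst (A (y2, 0)))" by (rule split_real[OF f(1)])
  hence "A (y1, 0) = l *\<^sub>R (y1, 0)" "A (y2, 0) = l *\<^sub>R (y2, 0)" using f(3) by (auto simp: prod_eq_iff)
  moreover have "y1 \<noteq> 0 \<or> y2 \<noteq> 0" using f(2) y(1) by (auto simp: zero_prod_def)
  ultimately show ?thesis using that y by blast
qed

end

text \<open>The terms at \<open>t = r / 2\<close> are bounded, so for
  \<open>\<bar>z\<bar> \<le> t / 2\<close> the series without its first term is at most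
  \<open>\<bar>z\<bar>\<close> times a geometric series of ratio 1/2.\<close>

lemma power_series_tendsto_at_0:
  fixes c :: "nat \<Rightarrow> 'a::banach"
  assumes r: "r > 0" and s: "\<And>z::real. z \<noteq> 0 \<Longrightarrow> \<bar>z\<bar> < r \<Longrightarrow> (\<lambda>n. z ^ n *\<^sub>R c n) sums S z"
  shows "(S \<longlongrightarrow> c 0) (at 0)"
proof -
  define t where "t = r / 2"
  have t: "0 < t" "t < r" using r by (auto simp: t_def)
  have "(\<lambda>n. t ^ n *\<^sub>R c n) \<longlonglongrightarrow> 0"
    using s[of t] t by (intro summable_LIMSEQ_zero) (auto simp: summable_def)
  hence "Bseq (\<lambda>n. t ^ n *\<^sub>R c n)" by (intro convergent_imp_Bseq) (auto simp: convergent_def)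
  then obtain C where C: "C > 0" "\<And>n. norm (t ^ n *\<^sub>R c n) \<le> C" by (auto simp: Bseq_def)
  have bound: "norm (S z - c 0) \<le> \<bar>z\<bar> * (2 * C / t)" if z: "z \<noteq> 0" "\<bar>z\<bar> \<le> t / 2" for z
  proof -
    have "(\<lambda>n. z ^ Suc n *\<^sub>R c (Suc n)) sums (S z - c 0)"
      using s[of z] z t by (subst sums_Suc_iff) simp
    hence Sz: "S z - c 0 = (\<Sum>n. z ^ Suc n *\<^sub>R c (Suc n))" by (simp add: sums_unique)
    have le: "norm (z ^ Suc n *\<^sub>R c (Suc n)) \<le> \<bar>z\<bar> * (C / t) * (1 / 2) ^ n" for n
    proof -
      have "norm (c (Suc n)) \<le> C / t ^ Suc n" using C(2)[of "Suc n"] t by (simp add: field_simps)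
      hence "norm (z ^ Suc n *\<^sub>R c (Suc n)) \<le> \<bar>z\<bar> ^ Suc n * (C / t ^ Suc n)"
        by (simp only: norm_scaleR norm_power real_norm_def power_abs) (intro mult_left_mono; simp)
      also have "\<dots> = \<bar>z\<bar> * (C / t) * (\<bar>z\<bar> / t) ^ n" using t by (simp add: power_divide field_simps)
      also have "\<dots> \<le> \<bar>z\<bar> * (C / t) * (1 / 2) ^ n"
        using z t C by (intro mult_left_mono power_mono) (auto simp: field_simps)
      finally show ?thesis .
    qed
    have gs: "(\<lambda>n. \<bar>z\<bar> * (C / t) * (1 / 2) ^ n) sums (\<bar>z\<bar> * (C / t) * 2)"
      using geometric_sums[of "1/2 :: real"] by (intro sums_mult) simp
    have "norm (\<Sum>n. z ^ Suc n *\<^sub>R c (Suc n)) \<le> \<bar>z\<bar> * (C / t) * 2"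
      unfolding sums_unique[OF gs] by (rule norm_suminf_le[OF le sums_summable[OF gs]])
    thus ?thesis unfolding Sz by (simp add: mult_ac)
  qed
  have "((\<lambda>z. S z - c 0) \<longlongrightarrow> 0) (at 0)"
  proof (rule Lim_null_comparison)
    show "\<forall>\<^sub>F z in at 0. norm (S z - c 0) \<le> \<bar>z\<bar> * (2 * C / t)"
      unfolding eventually_at using t bound by (intro exI[of _ "t / 2"]) auto
    have "((\<lambda>z::real. \<bar>z\<bar> * (2 * C / t)) \<longlongrightarrow> \<bar>0\<bar> * (2 * C / t)) (at 0)" by (intro tendsto_intros)
    thus "((\<lambda>z::real. \<bar>z\<bar> * (2 * C / t)) \<longlongrightarrow> 0) (at 0)" by simp
  qed
  thus ?thesis by (simp add: LIM_zero_iff)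
qed

section \<open>Poles of real operators whose domain lies in a principal ideal\<close>

locale real_operator_pole = real_operator A D
  for A :: "'r::real_banach_lattice \<times> 'r \<Rightarrow> 'r \<times> 'r" and D +
  fixes l0 r :: real and k :: nat and a b :: "nat \<Rightarrow> 'r \<times> 'r \<Rightarrow> 'r \<times> 'r" and u :: "'r \<times> 'r" and x :: 'r
  assumes r_pos: "0 < r"
    and a_bounded: "bounded_clinear_op (a n)" and b_bounded: "bounded_clinear_op (b n)"
    and punctured_disc: "0 < cmod (l - complex_of_real l0) \<Longrightarrow> cmod (l - complex_of_real l0) < r \<Longrightarrow> l \<in> \<rho>"
    and expansion: "0 < cmod (l - complex_of_real l0) \<Longrightarrow> cmod (l - complex_of_real l0) < r \<Longrightarrow>
      (\<lambda>n. cscale ((l - complex_of_real l0) ^ n) (a n f)) sums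
        (R l f - (\<Sum>j\<in>{1..k}. cscale (inverse ((l - complex_of_real l0) ^ j)) (b j f)))"
    and cpos_u: "cpos u" and D_ideal: "D \<subseteq> principal_ideal u" and D_dense: "closure D = UNIV"
    and x: "x \<noteq> 0" "(x, 0) \<in> D" "A (x, 0) = l0 *\<^sub>R (x, 0)"
begin

definition Z :: "real set" where "Z = {z. z \<noteq> 0 \<and> complex_of_real (l0 + z) \<in> \<rho>}"

definition Q :: "real \<Rightarrow> 'r \<times> 'r \<Rightarrow> 'r \<times> 'r" where "Q z = R (complex_of_real (l0 + z))"

text \<open>The Laurent expansion determines \<open>b j\<close> only for \<open>j\<close> between 1
  and \<open>k\<close>; elsewhere the family is arbitrary and is replaced by 0.\<close>

definition B :: "nat \<Rightarrow> 'r \<times> 'r \<Rightarrow> 'r \<times> 'r" where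
  "B j = (if 1 \<le> j \<and> j \<le> k then b j else (\<lambda>_. 0))"

lemma small_in_Z: "z \<noteq> 0 \<Longrightarrow> \<bar>z\<bar> < r \<Longrightarrow> z \<in> Z"
  using punctured_disc[of "complex_of_real (l0 + z)"] by (simp add: Z_def)

lemma Q_linear: "z \<in> Z \<Longrightarrow> bounded_linear (Q z)"
  unfolding Q_def by (rule resolvent_linear) (simp add: Z_def)

lemma B_linear: "bounded_linear (B j)"
  using b_bounded by (simp add: B_def bounded_clinear_op_imp_bounded_linear)

lemma B_cscale: "B j (cscale c f) = cscale c (B j f)"
  using bounded_clinear_op_cscale[OF b_bounded[of j]] by (simp add: B_def cscale_def zero_prod_def)

text \<open>The length \<open>Suc k\<close>, with a zero as last coefficient, meets the requirement
  of \<open>resolvent_pole\<close> that the length be at least 1 even when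
  \<open>k = 0\<close>.\<close>

lemma laurent_expansion: "has_principal_part (Suc k) (\<lambda>j. B j f) (a 0 f) (\<lambda>z. Q z f)"
  unfolding has_principal_part_def
proof (rule power_series_tendsto_at_0[OF r_pos])
  fix z :: real assume z: "z \<noteq> 0" "\<bar>z\<bar> < r"
  have "(\<Sum>j=1..Suc k. inverse (z ^ j) *\<^sub>R B j f)
      = (\<Sum>j\<in>{1..k}. cscale (inverse (complex_of_real z ^ j)) (b j f))"
  proof -
    have "(\<Sum>j=1..k. inverse (z ^ j) *\<^sub>R B j f)
       = (\<Sum>j\<in>{1..k}. cscale (complex_of_real (inverse (z ^ j))) (b j f))"
      unfolding cscale_of_real by (rule sum.cong) (auto simp: B_def)
    thus ?thesis by (simp add: B_def of_real_inverse of_real_power)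
  qed
  moreover have "cscale (complex_of_real z ^ n) (a n f) = z ^ n *\<^sub>R a n f" for n
    by (simp flip: of_real_power)
  ultimately show "(\<lambda>n. z ^ n *\<^sub>R a n f) sums (Q z f - (\<Sum>j=1..Suc k. inverse (z ^ j) *\<^sub>R B j f))"
    using expansion[of "complex_of_real (l0 + z)" f] z by (simp add: Q_def)
qed

sublocale C: resolvent_pole Q Z B "a 0" "Suc k"
proof (rule resolvent_pole.intro)
  show "\<forall>\<^sub>F z in at 0. z \<in> Z"
    unfolding eventually_at using small_in_Z r_pos by (intro exI[of _ r]) auto
  show "0 \<notin> Z" by (simp add: Z_def)
  show "Q z f - Q w f = (w - z) *\<^sub>R Q z (Q w f)" if "z \<in> Z" "w \<in> Z" for z w f
    using resolvent_difference[of "complex_of_real (l0 + z)" "complex_of_real (l0 + w)" f] that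
      cscale_of_real[of "w - z"]
    by (simp add: Z_def Q_def)
  show "has_principal_part (Suc k) (\<lambda>j. B j f) (a 0 f) (\<lambda>z. Q z f)" for f by (rule laurent_expansion)
  show "B j f = 0" if "Suc k < j" for j f using that by (simp add: B_def)
qed (use Q_linear B_linear in auto)

lemma Q_real: "z \<in> Z \<Longrightarrow> snd (Q z (y, 0)) = 0"
  unfolding Q_def by (rule resolvent_real) (simp add: Z_def)

lemma Q_real_eq: "z \<in> Z \<Longrightarrow> Q z (y, 0) = (fst (Q z (y, 0)), 0)"
  using Q_real by (simp add: prod_eq_iff)

text \<open>The imaginary parts are the coefficients of a function that vanishes near the
  pole.\<close>

lemma B_real: "snd (B j (y, 0)) = 0"
proof -
  have "has_principal_part (Suc k) (\<lambda>j. snd (B j (y, 0))) (snd (a 0 (y, 0))) (\<lambda>z. snd (Q z (y, 0)))"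
    by (rule has_principal_part_linear[OF bounded_linear_snd laurent_expansion])
  moreover have "\<forall>\<^sub>F z in at 0. snd (Q z (y, 0)) = 0" using C.Z_ev by eventually_elim (rule Q_real)
  ultimately have "snd (B j (y, 0)) = 0" if "j \<in> {1..Suc k}"
    using has_principal_part_unique(2)[OF _ has_principal_part_const[of "Suc k" 0]] that by blast
  thus ?thesis by (cases "j \<in> {1..Suc k}") (auto simp: B_def)
qed

lemma quasi_interior_u: "quasi_interior u"
proof -
  have "closure (principal_ideal u) = UNIV"
    using closure_mono[OF D_ideal] unfolding D_dense by blast
  with cpos_u show ?thesis by (simp only: quasi_interior_def)
qed

abbreviation Qr :: "real \<Rightarrow> 'r \<Rightarrow> 'r" where "Qr z y \<equiv> fst (Q z (y, 0))"

abbreviation Br :: "nat \<Rightarrow> 'r \<Rightarrow> 'r" where "Br j y \<equiv> fst (B j (y, 0))"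

lemma bounded_linear_real_part:
  fixes T :: "'r \<times> 'r \<Rightarrow> 'r \<times> 'r"
  assumes "bounded_linear T" shows "bounded_linear (\<lambda>y. fst (T (y, 0)))"
proof -
  have "bounded_linear (\<lambda>y::'r. (y, 0::'r))"
    by (intro bounded_linear_Pair bounded_linear_ident bounded_linear_zero)
  from bounded_linear_compose[OF bounded_linear_fst bounded_linear_compose[OF assms this]]
  show ?thesis .
qed

lemma fst_ideal:
  assumes "f \<in> principal_ideal u" shows "\<exists>c\<ge>0. labs (fst f) \<le> c *\<^sub>R fst u"
proof -
  obtain c where "c \<ge> 0" "\<And>t. labs (cos t *\<^sub>R fst f + sin t *\<^sub>R snd f) \<le> c *\<^sub>R fst u"
    using assms by (auto simp: principal_ideal_def)
  from this(1) this(2)[of 0] show ?thesis by auto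
qed

text \<open>The resolvents at real points map real vectors to real vectors, so their restrictions
  form a resolvent on the real lattice, where the order arguments take place.\<close>

sublocale dominated_resolvent_pole Qr Z Br "\<lambda>y. fst (a 0 (y, 0))" "Suc k" "fst u" x
proof (intro dominated_resolvent_pole.intro resolvent_pole.intro dominated_resolvent_pole_axioms.intro)
  show "\<forall>\<^sub>F z in at 0. z \<in> Z" by (rule C.Z_ev)
  show "0 \<notin> Z" by (rule C.zero_notin_Z)
  show "Qr z f - Qr w f = (w - z) *\<^sub>R Qr z (Qr w f)" if "z \<in> Z" "w \<in> Z" for z w f
    using C.resolvent_identity[OF that, of "(f, 0)"] Q_real_eq[OF that(2), of f]
    by (metis fst_diff fst_scaleR)
  show "has_principal_part (Suc k) (\<lambda>j. Br j f) (fst (a 0 (f, 0))) (\<lambda>z. Qr z f)" for f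
    by (rule has_principal_part_linear[OF bounded_linear_fst laurent_expansion])
  show "\<exists>M\<ge>0. \<forall>h. labs (Qr z h) \<le> (M * norm h) *\<^sub>R fst u" if z: "z \<in> Z" for z
  proof (rule linear_le_unit_bounded)
    show "bounded_linear (Qr z)" by (intro bounded_linear_real_part Q_linear z)
    show "0 \<le> fst u" using cpos_u by (simp add: cpos_def)
    show "\<exists>c\<ge>0. labs (Qr z h) \<le> c *\<^sub>R fst u" for h
      using resolvent_in_D[of "complex_of_real (l0 + z)" "(h, 0)"] z D_ideal
      by (intro fst_ideal) (auto simp: Q_def Z_def)
  qed
  show "closure {f. \<exists>c. labs f \<le> c *\<^sub>R fst u} = UNIV"
  proof -
    let ?I = "{f. \<exists>c. labs f \<le> c *\<^sub>R fst u}"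
    have "fst ` D \<subseteq> ?I" using fst_ideal D_ideal by blast
    also have "?I \<subseteq> closure ?I" by (rule closure_subset)
    finally have "fst ` closure D \<subseteq> closure ?I"
      by (intro image_closure_subset[OF continuous_on_fst[OF continuous_on_id] closed_closure])
    thus ?thesis unfolding D_dense by (auto simp: image_subset_iff)
  qed
  show "Qr z x = inverse z *\<^sub>R x" if "z \<in> Z" for z
    using resolvent_eigenvector[of "(x, 0)" "complex_of_real l0" "complex_of_real (l0 + z)"] x that
      cscale_of_real[of "inverse z" "(x, 0)"]
    by (simp add: Q_def Z_def)
  show "Br j f = 0" if "Suc k < j" for j f using that by (simp add: B_def)
qed (use cpos_u x Q_linear B_linear in \<open>auto simp: cpos_def intro: bounded_linear_real_part\<close>)

lemma strongly_pos_real: "strongly_pos u (y, 0) \<longleftrightarrow> sp y"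
  using cpos_u by (simp add: strongly_pos_def sp_def cpos_def)

lemma cstrictpos_real: "cstrictpos f \<longleftrightarrow> (\<exists>y. f = (y, 0) \<and> 0 < y)"
proof -
  have "cstrictpos (y, v) \<longleftrightarrow> v = 0 \<and> 0 < y" for y v
    unfolding cstrictpos_def cpos_def zero_prod_def order.strict_iff_order[of 0 y] by auto
  thus ?thesis by (cases f) simp
qed

lemma op_strongly_pos_residue: "op_strongly_pos u (B 1) \<longleftrightarrow> (\<forall>y>0. sp (Br 1 y))"
proof -
  have "B 1 (y, 0) = (Br 1 y, 0)" for y using B_real[of 1 y] by (simp add: prod_eq_iff)
  thus ?thesis unfolding op_strongly_pos_def cstrictpos_real
    by (metis strongly_pos_real)
qed

text \<open>The truncation leaves the residue unchanged only if \<open>1 \<le> k\<close>, which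
  follows because \<open>B 1\<close> fixes the nonzero eigenvector \<open>x\<close>.\<close>

lemma residue_eq: "b 1 = B 1"
proof -
  have "Br 1 x = x" by (rule eigenvector_coeffs(1)[OF eigenvector])
  hence "1 \<le> k" using x by (auto simp: B_def split: if_splits)
  thus ?thesis by (simp add: B_def)
qed

lemma strongly_pos_Q: "z \<in> Z \<Longrightarrow> strongly_pos u (R (complex_of_real (l0 + z)) (y, 0)) \<longleftrightarrow> sp (Qr z y)"
  using strongly_pos_real[of "Qr z y"] Q_real_eq[of z y] unfolding Q_def by metis

lemma strongly_neg_Q: "z \<in> Z \<Longrightarrow> strongly_neg u (R (complex_of_real (l0 + z)) (y, 0)) \<longleftrightarrow> sp (- Qr z y)"
proof -
  assume "z \<in> Z"
  hence "- R (complex_of_real (l0 + z)) (y, 0) = (- Qr z y, 0)"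
    using Q_real[of z y] by (simp add: Q_def prod_eq_iff)
  thus ?thesis by (simp only: strongly_neg_def strongly_pos_real)
qed

lemma residue_sp_eventually:
  assumes pos: "\<forall>y>0. sp (Br 1 y)" and y: "0 < y"
  shows "\<exists>d>0. d < r \<and> (\<forall>z. z \<noteq> 0 \<longrightarrow> \<bar>z\<bar> \<le> d \<longrightarrow> sp (z *\<^sub>R Qr z y))"
proof -
  have "\<forall>\<^sub>F z in at 0. sp (z *\<^sub>R Qr z y)"
    using pos y by (intro scaled_resolvent_sp simple_pole) auto
  then obtain d where d: "d > 0" "\<And>z. z \<noteq> 0 \<Longrightarrow> \<bar>z\<bar> < d \<Longrightarrow> sp (z *\<^sub>R Qr z y)"
    by (auto simp: eventually_at)
  show ?thesis using d r_pos by (intro exI[of _ "min d r / 2"]) auto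
qed

section \<open>Strong positivity of the residue and the sign of the resolvent on both sides of the
  pole\<close>

theorem residue_strongly_pos_iff_pos:
  "op_strongly_pos u (B 1) \<longleftrightarrow> indiv_ev_strongly_pos_at A D u l0"
  unfolding op_strongly_pos_residue
proof
  assume pos: "\<forall>y>0. sp (Br 1 y)"
  have Z: "l - l0 \<in> Z" if "l \<in> {l0<..l0 + r / 2}" for l
    using that r_pos by (intro small_in_Z) auto
  have "\<exists>l1\<in>{l0<..l0 + r / 2}. \<forall>l\<in>{l0<..l1}. strongly_pos u (R (complex_of_real l) f)"
    if f: "cstrictpos f" for f
  proof -
    obtain y where y: "f = (y, 0)" "0 < y" using f by (auto simp: cstrictpos_real)
    obtain d where d: "0 < d" "d < r" "\<And>z. z \<noteq> 0 \<Longrightarrow> \<bar>z\<bar> \<le> d \<Longrightarrow> sp (z *\<^sub>R Qr z y)"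
      using residue_sp_eventually[OF pos y(2)] by blast
    have "strongly_pos u (R (complex_of_real l) f)" if l: "l \<in> {l0<..l0 + d / 2}" for l
    proof -
      have "sp ((l - l0) *\<^sub>R Qr (l - l0) y)" using l d by (intro d(3)) auto
      hence "sp (Qr (l - l0) y)" using l by (subst (asm) sp_scaleR_iff) auto
      thus ?thesis using strongly_pos_Q[OF Z[of l], of y] l d y by simp
    qed
    thus ?thesis using d by (intro bexI[of _ "l0 + d / 2"]) auto
  qed
  moreover have "complex_of_real ` {l0<..l0 + r / 2} \<subseteq> \<rho>" using Z by (force simp: Z_def)
  ultimately show "indiv_ev_strongly_pos_at A D u l0"
    unfolding indiv_ev_strongly_pos_at_def using r_pos by (intro exI[of _ "l0 + r / 2"]) auto
next
  assume "indiv_ev_strongly_pos_at A D u l0"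
  then obtain l2 where l2: "l2 > l0" "complex_of_real ` {l0<..l2} \<subseteq> \<rho>"
     "\<And>f. cstrictpos f \<Longrightarrow> \<exists>l1\<in>{l0<..l2}. \<forall>l\<in>{l0<..l1}. strongly_pos u (R (complex_of_real l) f)"
    unfolding indiv_ev_strongly_pos_at_def by blast
  have "\<forall>\<^sub>F z in at_right 0. sp (1 *\<^sub>R Qr z y)" if y: "0 < y" for y
  proof -
    obtain l1 where l1: "l1 \<in> {l0<..l2}" "\<forall>l\<in>{l0<..l1}. strongly_pos u (R (complex_of_real l) (y, 0))"
      using l2(3)[of "(y, 0)"] y by (auto simp: cstrictpos_real)
    have "sp (Qr z y)" if z: "0 < z" "z < l1 - l0" for z
    proof -
      have "complex_of_real (l0 + z) \<in> \<rho>" using l2(2) z l1(1) by (intro subsetD[OF l2(2)] imageI) auto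
      hence "z \<in> Z" using z by (simp add: Z_def)
      moreover have "l0 + z \<in> {l0<..l1}" using z by auto
      ultimately show ?thesis using l1(2) strongly_pos_Q by blast
    qed
    thus ?thesis unfolding eventually_at_right_field using l1(1) by (intro exI[of _ "l1 - l0"]) auto
  qed
  thus "\<forall>y>0. sp (Br 1 y)"
    using residue_sp_of_resolvent_sign[of 1 "at_right 0"]
    by (simp add: at_le eventually_at_right_less)
qed

theorem residue_strongly_pos_iff_neg:
  "op_strongly_pos u (B 1) \<longleftrightarrow> indiv_ev_strongly_neg_at A D u l0"
  unfolding op_strongly_pos_residue
proof
  assume pos: "\<forall>y>0. sp (Br 1 y)"
  have Z: "l - l0 \<in> Z" if "l \<in> {l0 - r / 2..<l0}" for l
    using that r_pos by (intro small_in_Z) auto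
  have "\<exists>l1\<in>{l0 - r / 2..<l0}. \<forall>l\<in>{l1..<l0}. strongly_neg u (R (complex_of_real l) f)"
    if f: "cstrictpos f" for f
  proof -
    obtain y where y: "f = (y, 0)" "0 < y" using f by (auto simp: cstrictpos_real)
    obtain d where d: "0 < d" "d < r" "\<And>z. z \<noteq> 0 \<Longrightarrow> \<bar>z\<bar> \<le> d \<Longrightarrow> sp (z *\<^sub>R Qr z y)"
      using residue_sp_eventually[OF pos y(2)] by blast
    have "strongly_neg u (R (complex_of_real l) f)" if l: "l \<in> {l0 - d / 2..<l0}" for l
    proof -
      have "sp ((l - l0) *\<^sub>R Qr (l - l0) y)" using l d by (intro d(3)) auto
      hence "sp ((l0 - l) *\<^sub>R (- Qr (l - l0) y))" by (simp add: scaleR_diff_left)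
      hence "sp (- Qr (l - l0) y)" using l by (subst (asm) sp_scaleR_iff) auto
      thus ?thesis using strongly_neg_Q[OF Z[of l], of y] l d y by simp
    qed
    thus ?thesis using d by (intro bexI[of _ "l0 - d / 2"]) auto
  qed
  moreover have "complex_of_real ` {l0 - r / 2..<l0} \<subseteq> \<rho>" using Z by (force simp: Z_def)
  ultimately show "indiv_ev_strongly_neg_at A D u l0"
    unfolding indiv_ev_strongly_neg_at_def using r_pos by (intro exI[of _ "l0 - r / 2"]) auto
next
  assume "indiv_ev_strongly_neg_at A D u l0"
  then obtain l2 where l2: "l2 < l0" "complex_of_real ` {l2..<l0} \<subseteq> \<rho>"
     "\<And>f. cstrictpos f \<Longrightarrow> \<exists>l1\<in>{l2..<l0}. \<forall>l\<in>{l1..<l0}. strongly_neg u (R (complex_of_real l) f)"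
    unfolding indiv_ev_strongly_neg_at_def by blast
  have "\<forall>\<^sub>F z in at_left 0. sp ((- 1) *\<^sub>R Qr z y)" if y: "0 < y" for y
  proof -
    obtain l1 where l1: "l1 \<in> {l2..<l0}" "\<forall>l\<in>{l1..<l0}. strongly_neg u (R (complex_of_real l) (y, 0))"
      using l2(3)[of "(y, 0)"] y by (auto simp: cstrictpos_real)
    have "sp (- Qr z y)" if z: "z < 0" "l1 - l0 < z" for z
    proof -
      have "complex_of_real (l0 + z) \<in> \<rho>" using z l1(1) by (intro subsetD[OF l2(2)] imageI) auto
      hence "z \<in> Z" using z by (simp add: Z_def)
      moreover have "l0 + z \<in> {l1..<l0}" using z by auto
      ultimately show ?thesis using l1(2) strongly_neg_Q by blast
    qed
    thus ?thesis unfolding eventually_at_left_field using l1(1) by (intro exI[of _ "l1 - l0"]) auto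
  qed
  thus "\<forall>y>0. sp (Br 1 y)"
    using residue_sp_of_resolvent_sign[of "-1" "at_left 0"]
    by (simp add: at_le eventually_at_filter)
qed

section \<open>Strong positivity of the residue and powers of a resolvent\<close>

lemma Q_funpow_real:
  assumes z: "z \<in> Z" shows "(Q z ^^ n) (y, 0) = ((Qr z ^^ n) y, 0)"
proof (induction n)
  case (Suc n)
  have "Q z ((Qr z ^^ n) y, 0) = (Qr z ((Qr z ^^ n) y), 0)" by (rule Q_real_eq[OF z])
  with Suc show ?case by (simp only: funpow.simps o_apply)
qed simp

lemma indiv_ev_strongly_pos_op_iff:
  assumes z: "z \<in> Z"
  shows "indiv_ev_strongly_pos_op (R (complex_of_real (l0 + z))) u
    \<longleftrightarrow> (\<forall>y>0. \<exists>n0. \<forall>n\<ge>n0. sp ((Qr z ^^ n) y))"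
proof -
  have pow: "strongly_pos u ((R (complex_of_real (l0 + z)) ^^ n) (y, 0)) \<longleftrightarrow> sp ((Qr z ^^ n) y)" for n y
    unfolding Q_def[symmetric] Q_funpow_real[OF z] by (rule strongly_pos_real)
  have all: "(\<forall>f. cstrictpos f \<longrightarrow> X f) \<longleftrightarrow> (\<forall>y>0. X (y, 0))" for X
    unfolding cstrictpos_real by auto
  show ?thesis unfolding indiv_ev_strongly_pos_op_def by (simp only: all pow)
qed

text \<open>For \<open>w\<close> in the closed unit disc the point \<open>l0 + m - w (m - z)\<close>
  has real part at least \<open>l0 + z\<close>, so \<open>(m - z) Q m\<close> satisfies the
  assumptions of \<open>power_bounded_resolvent_scaled\<close>.\<close>

lemma powers_tendsto_zero_right:
  assumes half_plane: "\<And>l. l0 < Re l \<Longrightarrow> l \<in> \<rho>" and z: "0 < z" "z < m"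
  shows "(\<lambda>n. (m - z) ^ n *\<^sub>R (Qr m ^^ n) y) \<longlonglongrightarrow> 0"
proof -
  have mZ: "m \<in> Z" using z half_plane[of "complex_of_real (l0 + m)"] by (simp add: Z_def)
  interpret power_bounded_resolvent "\<lambda>f. cscale (complex_of_real (m - z)) (R (complex_of_real (l0 + m)) f)"
    "\<lambda>w g. g + cscale (w * complex_of_real (m - z)) (R (complex_of_real (l0 + m) - w * complex_of_real (m - z)) g)"
  proof (rule power_bounded_resolvent_scaled)
    show "complex_of_real (l0 + m) \<in> \<rho>" using z by (intro half_plane) simp
    fix w assume w: "cmod w \<le> 1"
    have "Re w * (m - z) \<le> 1 * (m - z)"
      using z complex_Re_le_cmod[of w] w by (intro mult_right_mono) auto
    hence "Re w * (m - z) < m" by (rule le_less_trans) (use z in simp)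
    thus "complex_of_real (l0 + m) - w * complex_of_real (m - z) \<in> \<rho>"
      using z by (intro half_plane) simp
  qed
  have eq: "((\<lambda>f. cscale (complex_of_real (m - z)) (R (complex_of_real (l0 + m)) f)) ^^ n) (y, 0)
     = ((m - z) ^ n *\<^sub>R (Qr m ^^ n) y, 0)" for n
  proof (induction n)
    case (Suc n)
    interpret Qm: bounded_linear "Q m" by (rule Q_linear[OF mZ])
    have "Q m (c *\<^sub>R h, 0) = (c *\<^sub>R Qr m h, 0)" for c h
      using Qm.scaleR[of c "(h, 0)"] Q_real_eq[OF mZ, of h] by (metis scaleR_Pair scaleR_zero_right fst_conv)
    with Suc show ?case by (simp add: Q_def[symmetric] del: of_real_diff of_real_add)
  qed simp
  show ?thesis using tendsto_fst[OF powers_tendsto_zero[of "(y, 0)"]] unfolding eq by (simp add: zero_prod_def)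
qed

text \<open>With \<open>P = B 1\<close>, the inverse of \<open>1 - w (m Q m - P)\<close> is \<open>1 + w m N\<close> where \<open>N\<close> is the
  resolvent at \<open>l0 + m - w m\<close> restricted to the kernel of \<open>P\<close>; at \<open>w = 1\<close> this point is \<open>l0\<close>,
  and the constant Laurent coefficient \<open>a 0\<close> takes over the role of the resolvent.\<close>

lemma powers_tendsto_residue:
  assumes half_plane: "\<And>l. l0 < Re l \<Longrightarrow> l \<in> \<rho>" and m: "0 < m"
    and simple: "\<And>y. Br 2 y = 0"
  shows "(\<lambda>n. m ^ n *\<^sub>R (Qr m ^^ n) y) \<longlonglongrightarrow> Br 1 y"
proof -
  define P where "P = B 1"
  define M where "M = Q m"
  define S where "S f = m *\<^sub>R M f - P f" for f
  define L where "L w = R (complex_of_real (l0 + m) - w * complex_of_real m)" for w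
  define N where "N w f = (if w = 1 then a 0 f else L w (f - P f))" for w f
  have mr: "complex_of_real (l0 + m) \<in> \<rho>" using m by (intro half_plane) simp
  hence mZ: "m \<in> Z" using m by (simp add: Z_def)
  interpret M: bounded_linear M unfolding M_def by (rule Q_linear[OF mZ])
  interpret P: bounded_linear P unfolding P_def by (rule B_linear)
  interpret a0: bounded_linear "a 0" by (rule bounded_clinear_op_imp_bounded_linear[OF a_bounded])
  \<comment> \<open>The assumption concerns real vectors; complex linearity extends it to
    pairs.\<close>
  have B2: "B 2 f = 0" for f
  proof -
    obtain y1 y2 where f: "f = (y1, y2)" by (cases f)
    have 0: "B 2 (y, 0) = 0" for y using simple[of y] B_real[of 2 y] by (simp add: prod_eq_iff)
    interpret B2: bounded_linear "B 2" by (rule B_linear)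
    have "f = (y1, 0) + cscale \<i> (y2, 0)" by (simp add: f cscale_def)
    hence "B 2 f = B 2 (y1, 0) + cscale \<i> (B 2 (y2, 0))" by (simp only: B2.add B_cscale)
    thus ?thesis by (simp add: 0 cscale_def zero_prod_def)
  qed
  have MP: "m *\<^sub>R M (P f) = P f" for f
    using C.coeff_recursion(1)[OF mZ, of 1 f] B2[of f] by (simp add: M_def P_def numeral_2_eq_2 M.zero[unfolded M_def])
  have PM: "P (M f) = M (P f)" for f unfolding P_def M_def by (rule C.Q_B_commute[OF mZ, symmetric]) simp
  have PP: "P (P f) = P f" for f unfolding P_def using C.coeff_mult(1)[of 1 1 f] by simp
  have aP: "a 0 (P f) = 0" for f unfolding P_def by (rule C.coeff_mult(2)) simp
  have Pa: "P (a 0 f) = 0" for f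
  proof -
    have "P (a 0 f) = a 0 (P f)" unfolding P_def
      by (rule C.coeff_commute(2)[OF B_linear]) (simp add: C.Q_B_commute)
    thus ?thesis by (simp add: aP)
  qed
  have Ma: "M (a 0 f) = a 0 (M f)" for f unfolding M_def by (rule C.Q_H_commute[OF mZ])
  have aeq: "m *\<^sub>R M (a 0 f) = a 0 f - M f + M (P f)" for f
    unfolding M_def P_def by (rule C.coeff_recursion(2)[OF mZ])
  \<comment> \<open>The closed unit disc meets the line of real part 1 only in the point 1, so every
    other \<open>w\<close> leads to a point strictly to the right of \<open>l0\<close>.\<close>
  have Lr: "complex_of_real (l0 + m) - w * complex_of_real m \<in> \<rho>" if w: "cmod w \<le> 1" "w \<noteq> 1" for w
  proof (rule half_plane)
    have "Re w \<noteq> 1"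
    proof
      assume "Re w = 1"
      hence "Im w = 0" using w(1) cmod_power2[of w] power_le_one[OF norm_ge_zero w(1), of 2] by simp
      with \<open>Re w = 1\<close> w(2) show False by (simp add: complex_eq_iff)
    qed
    hence "Re w < 1" using w(1) complex_Re_le_cmod[of w] by simp
    hence "Re w * m < 1 * m" using m by (intro mult_strict_right_mono)
    thus "l0 < Re (complex_of_real (l0 + m) - w * complex_of_real m)" by simp
  qed
  \<comment> \<open>These properties hold both for the resolvent on the kernel of \<open>P\<close>
    and for the constant Laurent coefficient at \<open>w = 1\<close>; the inverse of
    \<open>1 - w S\<close> is computed from them without distinguishing the cases.\<close>
  have N_all: "bounded_linear (N w) \<and> N w (cscale c f) = cscale c (N w f) \<and> P (N w f) = 0 \<and> N w (P f) = 0 \<and>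
        M (N w f) = N w (M f) \<and> N w f - M f + M (P f) = cscale (w * complex_of_real m) (M (N w f))"
    if w: "cmod w \<le> 1" for w f c
  proof (cases "w = 1")
    case True
    hence Nw: "N w = a 0" by (auto simp: N_def)
    have "a 0 f - M f + M (P f) = cscale (w * complex_of_real m) (M (a 0 f))"
      using aeq[of f] True by simp
    thus ?thesis
      unfolding Nw using aP Pa Ma a0.bounded_linear_axioms bounded_clinear_op_cscale[OF a_bounded] by auto
  next
    case False
    hence Nw: "N w = (\<lambda>f. L w (f - P f))" by (auto simp: N_def)
    note Lw = Lr[OF w False]
    interpret Lw: bounded_linear "L w" unfolding L_def by (rule resolvent_linear[OF Lw])
    have "L w (Q z g) = Q z (L w g)" if "z \<in> Z" for z g
      using that unfolding Q_def L_def Z_def by (intro resolvent_commute[OF Lw]) simp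
    hence PL: "P (L w g) = L w (P g)" for g
      unfolding P_def by (intro C.coeff_commute(1)[OF Lw.bounded_linear_axioms, symmetric]) auto
    have LM: "M (L w g) = L w (M g)" for g
      unfolding M_def Q_def L_def by (rule resolvent_commute[OF mr Lw])
    have "L w g - M g = cscale (w * complex_of_real m) (L w (M g))" for g
      using resolvent_difference[OF Lw mr, of g] by (simp add: L_def M_def Q_def)
    from this[of "f - P f"]
    have "L w (f - P f) - M f + M (P f) = cscale (w * complex_of_real m) (M (L w (f - P f)))"
      by (simp only: LM M.diff) (simp add: algebra_simps)
    moreover have "bounded_linear (\<lambda>f. L w (f - P f))"
      by (rule bounded_linear_compose[OF Lw.bounded_linear_axioms
            bounded_linear_sub[OF bounded_linear_ident P.bounded_linear_axioms]])
    moreover have "L w (cscale c f - P (cscale c f)) = cscale c (L w (f - P f))"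
      unfolding P_def B_cscale L_def by (simp only: resolvent_cscale[OF Lw] flip: cscale_diff_right)
    ultimately show ?thesis
      unfolding Nw by (simp add: PL P.diff PP Lw.zero LM M.diff PM)
  qed
  have N: "bounded_linear (N w)" "N w (cscale c f) = cscale c (N w f)" "P (N w f) = 0" "N w (P f) = 0"
      "M (N w f) = N w (M f)" "N w f - M f + M (P f) = cscale (w * complex_of_real m) (M (N w f))"
    if w: "cmod w \<le> 1" for w f c
    using N_all[OF w, of c f] by blast+
  have S_linear: "bounded_linear S" unfolding S_def
    by (intro bounded_linear_sub P.bounded_linear_axioms
        bounded_linear_compose[OF bounded_linear_scaleR_right M.bounded_linear_axioms])
  interpret S: bounded_linear S by (rule S_linear)
  have S_cscale: "S (cscale c f) = cscale c (S f)" for c f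
  proof -
    have "m *\<^sub>R cscale c g = cscale c (m *\<^sub>R g)" for g :: "'r \<times> 'r" by (simp add: cscale_def scaleR_diff_right scaleR_add_right mult.commute)
    thus ?thesis unfolding S_def P_def M_def Q_def
      by (simp only: resolvent_cscale[OF mr] B_cscale cscale_diff_right)
  qed
  interpret power_bounded_resolvent S "\<lambda>w g. g + cscale (w * complex_of_real m) (N w g)"
  proof (rule power_bounded_resolvent.intro)
    obtain K where "\<And>f. norm (S f) \<le> norm f * K" using S.bounded by blast
    thus "bounded_clinear_op S"
      unfolding bounded_clinear_op_def clinear_op_def by (auto simp: mult.commute S.add S_cscale)
  next
    fix w :: complex and g assume w: "cmod w \<le> 1"
    let ?c = "w * complex_of_real m"
    note N = N[OF w]
    interpret Nw: bounded_linear "N w" by (rule N)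
    show "bounded_linear (\<lambda>g. g + cscale ?c (N w g))"
      by (intro bounded_linear_add bounded_linear_ident bounded_linear_compose[OF bounded_linear_cscale] N)
    have SN: "S (N w g) = m *\<^sub>R M (N w g)" "N w (S g) = m *\<^sub>R M (N w g)"
      by (simp_all add: S_def N Nw.diff Nw.scaleR)
    have wm: "cscale w (m *\<^sub>R h) = cscale ?c h" for h
      using cscale_mult[of w "complex_of_real m" h] by simp
    have "cscale w (S g) = cscale ?c (M g - M (P g))"
      using MP[of g] wm[of "M g - M (P g)"] by (simp add: S_def scaleR_diff_right)
    also have "M g - M (P g) = N w g - cscale ?c (M (N w g))"
      using N(6)[of g] by (simp add: algebra_simps)
    finally have wS: "cscale w (S g) = cscale ?c (N w g) - cscale ?c (cscale ?c (M (N w g)))"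
      by (simp only: cscale_diff_right)
    have "N w (cscale w (S g)) = cscale ?c (M (N w g))" by (simp only: N(2) SN wm)
    thus "g - cscale w (S g) + cscale ?c (N w (g - cscale w (S g))) = g"
      by (simp only: Nw.diff cscale_diff_right wS) (simp add: algebra_simps)
    have cw: "cscale w (cscale ?c h) = cscale ?c (cscale w h)" for h :: "'r \<times> 'r"
      by (simp only: mult.commute flip: cscale_mult)
    have "cscale w (S (cscale ?c (N w g))) = cscale ?c (cscale ?c (M (N w g)))"
      by (simp only: S_cscale SN cw wm)
    thus "g + cscale ?c (N w g) - cscale w (S (g + cscale ?c (N w g))) = g"
      by (simp only: S.add cscale_add_right wS) (simp add: algebra_simps)
  qed
  have MnP: "m ^ n *\<^sub>R (M ^^ n) (P f) = P f" for n f
  proof (induction n)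
    case (Suc n)
    have "m ^ Suc n *\<^sub>R (M ^^ Suc n) (P f) = m *\<^sub>R M (m ^ n *\<^sub>R (M ^^ n) (P f))"
      by (simp add: M.scaleR)
    thus ?case by (simp only: Suc MP)
  qed simp
  have PMn: "P ((M ^^ n) f) = (M ^^ n) (P f)" for n f by (induction n) (simp_all add: PM)
  \<comment> \<open>\<open>P\<close> is a projection that commutes with \<open>M\<close> and
    satisfies \<open>m M P = P\<close>, so the mixed terms cancel. The formula starts at exponent 1,
    because the zeroth power of \<open>S\<close> is the identity.\<close>
  have Sn: "(S ^^ Suc n) f = m ^ Suc n *\<^sub>R (M ^^ Suc n) f - P f" for n f
  proof (induction n)
    case (Suc n)
    have "(S ^^ Suc (Suc n)) f = S (m ^ Suc n *\<^sub>R (M ^^ Suc n) f - P f)"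
      using Suc by (simp only: funpow.simps o_apply)
    also have "\<dots> = m *\<^sub>R M (m ^ Suc n *\<^sub>R (M ^^ Suc n) f) - m *\<^sub>R M (P f)
       - (m ^ Suc n *\<^sub>R P ((M ^^ Suc n) f) - P (P f))"
      by (simp only: S_def M.diff P.diff P.scaleR scaleR_diff_right)
    also have "\<dots> = m *\<^sub>R M (m ^ Suc n *\<^sub>R (M ^^ Suc n) f) - P f"
      by (simp only: MP PMn MnP PP diff_self diff_zero)
    also have "\<dots> = m ^ Suc (Suc n) *\<^sub>R (M ^^ Suc (Suc n)) f - P f" by (simp add: M.scaleR)
    finally show ?case .
  qed (simp add: S_def)
  have "(\<lambda>n. m ^ Suc n *\<^sub>R (M ^^ Suc n) (y, 0) - P (y, 0)) \<longlonglongrightarrow> 0"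
    using LIMSEQ_Suc[OF powers_tendsto_zero[of "(y, 0)"]] unfolding Sn .
  hence "(\<lambda>n. m ^ Suc n *\<^sub>R (M ^^ Suc n) (y, 0)) \<longlonglongrightarrow> P (y, 0)" by (rule LIM_zero_cancel)
  hence "(\<lambda>n. m ^ n *\<^sub>R (M ^^ n) (y, 0)) \<longlonglongrightarrow> P (y, 0)" by (rule LIMSEQ_imp_Suc)
  from tendsto_fst[OF this] show ?thesis by (simp add: M_def P_def Q_funpow_real[OF mZ])
qed

theorem residue_strongly_pos_iff_powers:
  assumes sb: "ereal l0 = spectral_bound A D"
  shows "op_strongly_pos u (B 1) \<longleftrightarrow>
      (\<exists>l. ereal l > spectral_bound A D \<and> indiv_ev_strongly_pos_op (R (complex_of_real l)) u)" (is ?ex)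
    and "op_strongly_pos u (B 1) \<longleftrightarrow>
      (\<forall>l. ereal l > spectral_bound A D \<longrightarrow> indiv_ev_strongly_pos_op (R (complex_of_real l)) u)" (is ?all)
proof -
  \<comment> \<open>This is the only form in which the equality of \<open>l0\<close> and the
    spectral bound enters the convergence of powers.\<close>
  have half_plane: "l \<in> \<rho>" if l: "l0 < Re l" for l
  proof (rule ccontr)
    assume "l \<notin> \<rho>"
    hence "ereal (Re l) \<le> spectral_bound A D"
      unfolding spectral_bound_def by (intro Sup_upper) (auto simp: op_spectrum_def)
    thus False using l by (simp flip: sb)
  qed
  have inZ: "m \<in> Z" if "0 < m" for m
    using that half_plane[of "complex_of_real (l0 + m)"] by (simp add: Z_def)
  have iff: "indiv_ev_strongly_pos_op (R (complex_of_real l)) u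
      \<longleftrightarrow> (\<forall>y>0. \<exists>n0. \<forall>n\<ge>n0. sp ((Qr (l - l0) ^^ n) y))" if "l0 < l" for l
    using indiv_ev_strongly_pos_op_iff[OF inZ[of "l - l0"]] that by simp
  have all: "indiv_ev_strongly_pos_op (R (complex_of_real l)) u" if P: "op_strongly_pos u (B 1)" and l: "l0 < l" for l
  proof -
    have pos: "\<forall>y>0. sp (Br 1 y)" using P unfolding op_strongly_pos_residue .
    have simple: "Br j y = 0" if "2 \<le> j" for j y using pos that by (intro simple_pole) auto
    show ?thesis unfolding iff[OF l]
    proof (intro allI impI)
      fix y :: 'r assume y: "0 < y"
      show "\<exists>n0. \<forall>n\<ge>n0. sp ((Qr (l - l0) ^^ n) y)"
      proof (rule powers_sp)
        show "(\<lambda>n. (l - l0) ^ n *\<^sub>R (Qr (l - l0) ^^ n) y) \<longlonglongrightarrow> Br 1 y"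
          using l by (intro powers_tendsto_residue half_plane simple) auto
      qed (use simple pos y l inZ in auto)
    qed
  qed
  have ex: "op_strongly_pos u (B 1)"
    if l: "l0 < l" and R: "indiv_ev_strongly_pos_op (R (complex_of_real l)) u" for l
    unfolding op_strongly_pos_residue
  proof (intro allI impI)
    fix y :: 'r assume y: "0 < y"
    show "sp (Br 1 y)"
    proof (rule residue_sp_of_powers[where m = "l - l0"])
      show "{0<..l - l0} \<subseteq> Z" using inZ by auto
      show "(\<lambda>n. (l - l0 - z) ^ n *\<^sub>R (Qr (l - l0) ^^ n) f) \<longlonglongrightarrow> 0" if "0 < z" "z < l - l0" for z f
        using that by (intro powers_tendsto_zero_right half_plane) auto
      show "\<exists>n0. \<forall>n\<ge>n0. sp ((Qr (l - l0) ^^ n) f)" if "0 < f" for f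
        using R that unfolding iff[OF l] by blast
    qed (use l y in auto)
  qed
  have gt: "l0 < l \<longleftrightarrow> ereal l > spectral_bound A D" for l by (simp flip: sb)
  \<comment> \<open>A point to the right of the spectral bound, so that the universal statement
    yields the existential one.\<close>
  have "l0 < l0 + 1" by simp
  with all ex gt show ?ex ?all by blast+
qed

end

section \<open>Characterization of strongly positive spectral projections\<close>

theorem theorem4p4:
  fixes A :: "'r::real_banach_lattice \<times> 'r \<Rightarrow> 'r \<times> 'r"
    and D :: "('r \<times> 'r) set"
    and l0 :: real
    and P :: "'r \<times> 'r \<Rightarrow> 'r \<times> 'r"
    and u :: "'r \<times> 'r"
  assumes lin: "clinear_op A D"
    and closedA: "closed_op A D"
    and dense: "densely_defined A D"
    and realA: "real_op A D"
    and eig: "is_eigenvalue A D (complex_of_real l0)"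
    and pole: "resolvent_pole_with_residue A D (complex_of_real l0) P"
    and upos: "cpos u"
    and dom: "D \<subseteq> principal_ideal u"
  shows "quasi_interior u
    \<and> (op_strongly_pos u P \<longleftrightarrow> indiv_ev_strongly_pos_at A D u l0)
    \<and> (op_strongly_pos u P \<longleftrightarrow> indiv_ev_strongly_neg_at A D u l0)
    \<and> (ereal l0 = spectral_bound A D \<longrightarrow>
         (op_strongly_pos u P \<longleftrightarrow>
            (\<exists>l. ereal l > spectral_bound A D \<and>
                 indiv_ev_strongly_pos_op (op_resolvent A D (complex_of_real l)) u))
       \<and> (op_strongly_pos u P \<longleftrightarrow>
            (\<forall>l. ereal l > spectral_bound A D \<longrightarrow>
                 indiv_ev_strongly_pos_op (op_resolvent A D (complex_of_real l)) u)))"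
proof -
  interpret op: real_operator A D by unfold_locales (rule lin realA)+
  obtain x where x: "x \<noteq> 0" "(x, 0) \<in> D" "A (x, 0) = l0 *\<^sub>R (x, 0)"
    by (rule op.real_eigenvector[OF eig])
  obtain r k a b where *: "r > 0" "\<And>n. bounded_clinear_op (a n)" "\<And>j. bounded_clinear_op (b j)" "P = b 1"
    and disc: "\<And>l. 0 < cmod (l - complex_of_real l0) \<Longrightarrow> cmod (l - complex_of_real l0) < r \<Longrightarrow>
        l \<in> resolvent_set A D \<and>
        (\<forall>f. (\<lambda>n. cscale ((l - complex_of_real l0) ^ n) (a n f)) sums
          (op_resolvent A D l f - (\<Sum>j\<in>{1..k}. cscale (inverse ((l - complex_of_real l0) ^ j)) (b j f))))"
    using pole unfolding resolvent_pole_with_residue_def by blast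
  interpret p: real_operator_pole A D l0 r k a b u x
  proof (rule real_operator_pole.intro[OF op.real_operator_axioms], rule real_operator_pole_axioms.intro)
    show "closure D = UNIV" using dense by (simp add: densely_defined_def)
  qed (use * disc upos dom x in blast)+
  have P: "P = p.B 1" using * p.residue_eq by simp
  show ?thesis
    unfolding P using p.quasi_interior_u p.residue_strongly_pos_iff_pos p.residue_strongly_pos_iff_neg
      p.residue_strongly_pos_iff_powers by blast
qed

end
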